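(* Let $(f,g),(f',g')\in\Theta$ both have representation dimension $m$, and assume that the covariance matrices $\mathrm{Cov}_{x\sim p_x}(f(x))$ and $\mathrm{Cov}_{x\sim p_x}(f'(x))$ are invertible and that the unembedding matrices $L=(g(y_1)\ \cdots\ g(y_k))$ and $L'=(g'(y_1)\ \cdots\ g'(y_k))\in\mathbb R^{m\times k}$ have rank $m$. Let $\Sigma_{u,u}=\mathbb E_{x\sim p_x}[u(x)u(x)^\top]-\mathbb E_{x\sim p_x}[u(x)]\,\mathbb E_{x\sim p_x}[u(x)]^\top$ and let $\mu_m$ be its $m$-th largest eigenvalue; assume $\mu_m>0$. Then $$m_{\mathrm{CCA}}(f(x),f'(x))\;\ge\;1-\frac{d_{\mathrm{logit}}^2(p_{f,g},p_{f',g'})}{m\,\mu_m},$$ where $x\sim p_x$, and the same lower bound holds for $m_{\mathrm{CCA}}(g(Y),g'(Y))$ with $Y$ uniformly distributed on $\mathcal Y$.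
   Context: Model class $\Theta$: pairs $(f,g)$, $f:\mathcal X\to\mathbb R^m$, $g:\mathcal Y\to\mathbb R^m$ with $\mathcal Y=\{y_1,\dots,y_k\}$ finite, $\sum_y g(y)=0$, inducing $p_{f,g}(y\mid x)\propto\exp(f(x)^\top g(y))$; $x$ is distributed according to a data distribution $p_x$. Logits $u(x)=(f(x)^\top g(y_i))_{i=1}^k$, $u'(x)$ analogously; $d_{\mathrm{logit}}^2(p_{f,g},p_{f',g'})=\mathbb E_{x\sim p_x}\|u(x)-u'(x)\|_2^2$. For random vectors $X,Y\in\mathbb R^m$ with invertible covariances, the canonical correlations $\rho_1\ge\dots\ge\rho_m$ are the singular values of $\Sigma_{XX}^{-1/2}\Sigma_{XY}\Sigma_{YY}^{-1/2}$ (covariances and cross-covariance), and $m_{\mathrm{CCA}}(X,Y)=\frac1m\sum_{i=1}^m\rho_i$. *)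

theory Defs
  imports "HOL-Probability.Probability" "Jordan_Normal_Form.Char_Poly" "Jordan_Normal_Form.DL_Rank"
begin

definition cross_cov :: "'a measure \<Rightarrow> ('a \<Rightarrow> real vec) \<Rightarrow> ('a \<Rightarrow> real vec) \<Rightarrow> nat \<Rightarrow> nat \<Rightarrow> real mat" where
  "cross_cov M X Y d1 d2 = mat d1 d2 (\<lambda>(i,j).
      (\<integral>\<omega>. vec_index (X \<omega>) i * vec_index (Y \<omega>) j \<partial>M)
      - (\<integral>\<omega>. vec_index (X \<omega>) i \<partial>M) * (\<integral>\<omega>. vec_index (Y \<omega>) j \<partial>M))"

definition cov :: "'a measure \<Rightarrow> ('a \<Rightarrow> real vec) \<Rightarrow> nat \<Rightarrow> real mat" where
  "cov M X d = cross_cov M X X d d"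

text \<open>Inverse principal square root S^(-1/2) of a symmetric positive definite n x n matrix S:
  the unique symmetric positive definite R with R R = S^(-1).\<close>
definition inv_sqrt_mat :: "nat \<Rightarrow> real mat \<Rightarrow> real mat" where
  "inv_sqrt_mat n S = (THE R. R \<in> carrier_mat n n \<and> transpose_mat R = R
      \<and> (\<forall>v\<in>carrier_vec n. v \<noteq> 0\<^sub>v n \<longrightarrow> scalar_prod v (R *\<^sub>v v) > 0)
      \<and> R * R * S = 1\<^sub>m n)"

definition eigenvalues_mset :: "real mat \<Rightarrow> real multiset" where
  "eigenvalues_mset A = proots (char_poly A)"

definition eig_desc :: "real mat \<Rightarrow> nat \<Rightarrow> real" where
  "eig_desc A j = rev (sorted_list_of_multiset (eigenvalues_mset A)) ! (j - 1)"

definition singular_values :: "real mat \<Rightarrow> real multiset" where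
  "singular_values C = image_mset sqrt (eigenvalues_mset (transpose_mat C * C))"

definition m_CCA :: "'a measure \<Rightarrow> ('a \<Rightarrow> real vec) \<Rightarrow> ('a \<Rightarrow> real vec) \<Rightarrow> nat \<Rightarrow> real" where
  "m_CCA M X Y d =
     (let C = inv_sqrt_mat d (cov M X d) * cross_cov M X Y d d * inv_sqrt_mat d (cov M Y d)
      in sum_mset (singular_values C) / real d)"

text \<open>Logits u(x) = (f(x)^T g(y_i))_{i<k}, labels y_1..y_k indexed by 0..k-1.\<close>
definition logits :: "('x \<Rightarrow> real vec) \<Rightarrow> (nat \<Rightarrow> real vec) \<Rightarrow> nat \<Rightarrow> 'x \<Rightarrow> real vec" where
  "logits f g k x = vec k (\<lambda>i. scalar_prod (f x) (g i))"

definition d_logit_sq :: "'x measure \<Rightarrow> ('x \<Rightarrow> real vec) \<Rightarrow> (nat \<Rightarrow> real vec)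
    \<Rightarrow> ('x \<Rightarrow> real vec) \<Rightarrow> (nat \<Rightarrow> real vec) \<Rightarrow> nat \<Rightarrow> real" where
  "d_logit_sq M f g f' g' k =
     (\<integral>x. (\<Sum>i<k. (scalar_prod (f x) (g i) - scalar_prod (f' x) (g' i))\<^sup>2) \<partial>M)"

definition unemb :: "(nat \<Rightarrow> real vec) \<Rightarrow> nat \<Rightarrow> nat \<Rightarrow> real mat" where
  "unemb g m k = mat m k (\<lambda>(i,j). vec_index (g j) i)"

end

(* Write X = f(x), X' = f'(x), with covariances S, S' and cross-covariance C, and let K be the whitened
   cross-covariance S^(-1/2) C S'^(-1/2), whose singular values rho_i lie in [0,1]. Since rho_i >= rho_i^2,
   it suffices to bound m - tr(K K^T) = tr(1 - K K^T). The squared logit distance is at least the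
   variance of L^T X - L'^T X', which is at least the residual variance of the linear regression of
   L^T X on X', namely tr((1 - K K^T) S^(1/2) L L^T S^(1/2)). The matrix S^(1/2) L L^T S^(1/2) has the
   same m nonzero eigenvalues as the logit covariance L^T S L, hence dominates mu_m times the
   identity. The pairing of (S, C, S') with (L L^T, L L'^T, L' L'^T) is symmetric, so the same
   inequality with exchanged roles yields the bound for the unembeddings, whose covariances under the
   uniform distribution are (1/k) L L^T, (1/k) L' L'^T and (1/k) L L'^T. *)

theory Submission
  imports Defs "Jordan_Normal_Form.Spectral_Radius" "Jordan_Normal_Form.Schur_Decomposition"
begin

no_notation Inner_Product.real_inner_class.inner (infix "\<bullet>" 70)
no_notation Finite_Cartesian_Product.vec.vec_nth (infixl "$" 90)

section \<open>Spectral theorem for real symmetric matrices\<close>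

text \<open>That S^(1/2) L L^T S^(1/2) dominates mu_m times the identity rests on a spectral gap.
  The k x k matrix A = L^T S L has at most m nonzero eigenvalues, while m of them are at least mu_m
  > 0; so every eigenvalue of A is 0 or at least mu_m. Hence A^2 >= mu_m A and A^3 >= mu_m A^2.
  Since L is surjective, evaluating these two inequalities at suitable vectors gives L L^T >= mu_m
  S^(-1) and S >= mu_m (L L^T)^(-1), one for each of the two claims, without carrying eigenvectors
  from one matrix to another. The mean-zero convention on g and g' makes the covariances under the
  uniform distribution exact Gram matrices; their factor 1/k multiplies both sides of the trace
  inequality and cancels. Residual variances appear as traces: a joint covariance form is summed
  over the columns of a well-chosen pair of matrices, so no block matrix is formed.
  \<open>inv_sqrt_mat\<close> is a definite description, so uniqueness of positive definite square
  roots has to be proved before anything is known about it.\<close>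

lemma symmetric_real_eigenvalue:
  fixes A :: "real mat"
  assumes A: "A \<in> carrier_mat n n" and sym: "transpose_mat A = A" and n: "n \<noteq> 0"
  shows "\<exists>e. eigenvalue A e"
proof -
  let ?C = "map_mat complex_of_real A"
  have C: "?C \<in> carrier_mat n n" using A by auto
  have Csym: "transpose_mat ?C = ?C"
    using sym A by (metis map_mat_transpose)
  from spectrum_non_empty[OF C] n obtain c where ev: "eigenvalue ?C c"
    unfolding spectrum_def by auto
  then obtain v where v: "v \<in> carrier_vec n" "v \<noteq> 0\<^sub>v n" "?C *\<^sub>v v = c \<cdot>\<^sub>v v"
    unfolding eigenvalue_def eigenvector_def using C by auto
  have cv: "conjugate v \<in> carrier_vec n" using v by auto
  have conj: "?C *\<^sub>v conjugate v = conjugate (?C *\<^sub>v v)"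
    using A v(1) by (intro eq_vecI) (auto simp: scalar_prod_def)
  \<comment> \<open>A complex root always exists. Moving the symmetric real matrix across the
    Hermitian product replaces \<open>c\<close> by its conjugate, so \<open>c\<close> is real and is
    already a root of the real characteristic polynomial.\<close>
  have "(?C *\<^sub>v v) \<bullet> conjugate v = v \<bullet> (?C *\<^sub>v conjugate v)"
    using transpose_vec_mult_scalar[OF C cv v(1)] Csym by simp
  also have "\<dots> = cnj c * (v \<bullet>c v)"
    unfolding conj v(3) using v(1) by (simp add: conjugate_smult_vec)
  finally have "c * (v \<bullet>c v) = cnj c * (v \<bullet>c v)"
    unfolding v(3) using v(1) by simp
  moreover have "v \<bullet>c v \<noteq> 0" using v by simp
  ultimately have "c = cnj c" by simp
  then have c: "c = complex_of_real (Re c)" by (metis Reals_cnj_iff of_real_Re)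
  have "poly (char_poly ?C) c = 0" using ev eigenvalue_root_char_poly[OF C] by simp
  then have "complex_of_real (poly (char_poly A) (Re c)) = 0"
    using c of_real_hom.char_poly_hom[OF A] by (metis of_real_hom.poly_map_poly)
  then show ?thesis using eigenvalue_root_char_poly[OF A] by auto
qed

text \<open>Gram-Schmidt applied to a basis completion of \<open>v\<close> keeps \<open>v\<close> in
  front but does not normalise. Rescaling the columns changes only lengths, so the direction of
  \<open>v\<close> survives, which is all that deflation needs.\<close>

lemma orthonormal_matrix_with_first_col:
  fixes v :: "real vec"
  assumes v: "v \<in> carrier_vec n" "v \<noteq> 0\<^sub>v n"
  shows "\<exists>W c. W \<in> carrier_mat n n \<and> transpose_mat W * W = 1\<^sub>m n \<and> col W 0 = c \<cdot>\<^sub>v v"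
proof -
  interpret cof_vec_space n "TYPE(real)" .
  define b where "b = basis_completion v"
  define ws where "ws = gram_schmidt n b"
  from basis_completion[OF v, folded b_def]
  have dist_b: "distinct b" 
    and indep: "\<not> lin_dep (set b)" and b: "set b \<subseteq> carrier_vec n" and hdb: "hd b = v" 
    and len_b: "length b = n" by auto
  have n: "n \<noteq> 0" using v by auto
  from hdb len_b n obtain vs where bv: "b = v # vs" by (cases b, auto)
  from gram_schmidt_result[OF b dist_b indep refl, folded ws_def]
  have ws: "set ws \<subseteq> carrier_vec n" "corthogonal ws" "length ws = n" 
    by (auto simp: len_b)
  from gram_schmidt_hd[OF v(1), of vs, folded bv] have hdws: "hd ws = v" unfolding ws_def .
  then have ws0: "ws ! 0 = v" using ws n by (cases ws) auto
  define q where "q i = 1 / sqrt (ws ! i \<bullet> ws ! i)" for i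
  define W where "W = mat_of_cols n (map (\<lambda>i. q i \<cdot>\<^sub>v (ws ! i)) [0..<n])"
  have wsc: "i < n \<Longrightarrow> ws ! i \<in> carrier_vec n" for i using ws by auto
  have W: "W \<in> carrier_mat n n" unfolding W_def by auto
  have colW: "i < n \<Longrightarrow> col W i = q i \<cdot>\<^sub>v (ws ! i)" for i
    unfolding W_def by (subst col_mat_of_cols) (use wsc in auto)
  \<comment> \<open>The equivalence also covers \<open>i = j\<close>: no vector has norm zero, so
    the divisions in \<open>q\<close> are legitimate.\<close>
  have orth: "(ws ! i \<bullet> ws ! j = 0) = (i \<noteq> j)" if "i < n" "j < n" for i j
    using corthogonalD[OF ws(2), of i j] that ws by (simp add: conjugate_vec_def)
  have "transpose_mat W * W = 1\<^sub>m n"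
  proof (rule eq_matI)
    fix i j assume ij: "i < dim_row (1\<^sub>m n :: real mat)" "j < dim_col (1\<^sub>m n :: real mat)"
    then have "(transpose_mat W * W) $$ (i,j) = q i * q j * (ws ! i \<bullet> ws ! j)"
      using W wsc by (simp add: colW smult_scalar_prod_distrib[of _ n] scalar_prod_smult_distrib[of _ n])
    moreover have "0 \<le> ws ! i \<bullet> ws ! i" by (simp add: scalar_prod_def sum_nonneg)
    ultimately show "(transpose_mat W * W) $$ (i,j) = 1\<^sub>m n $$ (i,j)"
      using ij orth[of i j] by (cases "i = j") (auto simp: q_def)
  qed (use W in auto)
  moreover have "col W 0 = q 0 \<cdot>\<^sub>v v" using colW[of 0] n ws0 by simp
  ultimately show ?thesis using W by blast
qed

lemma block_diag_mult:
  assumes "A \<in> carrier_mat p p" "A' \<in> carrier_mat p p" "B \<in> carrier_mat q q" "B' \<in> carrier_mat q q"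
  shows "four_block_mat A (0\<^sub>m p q) (0\<^sub>m q p) B * four_block_mat A' (0\<^sub>m p q) (0\<^sub>m q p) B'
    = four_block_mat (A * A') (0\<^sub>m p q) (0\<^sub>m q p) (B * B' :: real mat)"
  by (subst mult_four_block_mat[of _ p p _ q _ q _ _ p _ q]) (use assms in auto)

text \<open>Deflation: in an orthonormal basis that starts with an eigenvector, the first column of
  the matrix is a multiple of the first unit vector. Symmetry gives the same for the first row, so a
  smaller symmetric block splits off for the induction.\<close>

theorem spectral_theorem_symmetric:
  fixes A :: "real mat"
  assumes "A \<in> carrier_mat n n" and "transpose_mat A = A"
  shows "\<exists>U d. U \<in> carrier_mat n n \<and> transpose_mat U * U = 1\<^sub>m n \<and> U * transpose_mat U = 1\<^sub>m n
    \<and> A = U * mat_diag n d * transpose_mat U"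
  using assms
proof (induction n arbitrary: A)
  case 0
  then show ?case
    by (intro exI[of _ "1\<^sub>m 0"] exI[of _ "\<lambda>_. 0"]) (auto intro!: eq_matI)
next
  case (Suc n A)
  note A = Suc.prems(1) and sym = Suc.prems(2)
  obtain e v where v: "v \<in> carrier_vec (Suc n)" "v \<noteq> 0\<^sub>v (Suc n)" "A *\<^sub>v v = e \<cdot>\<^sub>v v"
    using symmetric_real_eigenvalue[OF A sym] A unfolding eigenvalue_def eigenvector_def by auto
  obtain W c where W: "W \<in> carrier_mat (Suc n) (Suc n)" "transpose_mat W * W = 1\<^sub>m (Suc n)" 
    and col: "col W 0 = c \<cdot>\<^sub>v v"
    using orthonormal_matrix_with_first_col[OF v(1,2)] by blast
  have WW: "W * transpose_mat W = 1\<^sub>m (Suc n)"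
    using mat_mult_left_right_inverse[OF _ W(1,2)] W(1) by auto
  define B where "B = transpose_mat W * A * W"
  have B: "B \<in> carrier_mat (Suc n) (Suc n)" using W A unfolding B_def by auto
  have Bsym: "transpose_mat B = B"
    unfolding B_def using W(1) A sym
    by (simp add: transpose_mult[of _ "Suc n" "Suc n" _ "Suc n"] assoc_mult_mat[of _ "Suc n" "Suc n" _ "Suc n" _ "Suc n"])
  have colW: "col W 0 \<in> carrier_vec (Suc n)"
    by (metis W(1) carrier_matD(1) col_dim)
  have Bi0: "B $$ (i,0) = (if i = 0 then e else 0)" if i: "i < Suc n" for i
  proof -
    have "col B 0 = (transpose_mat W * A) *\<^sub>v col W 0"
      unfolding B_def using W A by (subst col_mult2[of _ "Suc n" "Suc n" _ "Suc n"]) auto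
    also have "\<dots> = transpose_mat W *\<^sub>v (A *\<^sub>v col W 0)"
      using W A colW by (subst assoc_mult_mat_vec[of _ "Suc n" "Suc n" _ "Suc n"]) auto
    also have "A *\<^sub>v col W 0 = e \<cdot>\<^sub>v col W 0"
      unfolding col using A v by (simp add: mult_mat_vec[of _ "Suc n" "Suc n"] smult_smult_assoc mult.commute)
    also have "transpose_mat W *\<^sub>v (e \<cdot>\<^sub>v col W 0) = e \<cdot>\<^sub>v (transpose_mat W *\<^sub>v col W 0)"
      using W colW by (intro mult_mat_vec[of _ "Suc n" "Suc n"]) auto
    also have "transpose_mat W *\<^sub>v col W 0 = col (transpose_mat W * W) 0"
      using W by (subst col_mult2[of _ "Suc n" "Suc n" _ "Suc n"]) auto
    also have "\<dots> = unit_vec (Suc n) 0" unfolding W(2) by simp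
    finally have "col B 0 $ i = (e \<cdot>\<^sub>v unit_vec (Suc n) 0) $ i" by simp
    then show ?thesis using B i by auto
  qed
  have B0i: "B $$ (0,i) = (if i = 0 then e else 0)" if i: "i < Suc n" for i
    using Bi0[OF i] Bsym B i by (metis carrier_matD index_transpose_mat(1) zero_less_Suc)
  define B1 where "B1 = mat n n (\<lambda>(i,j). B $$ (Suc i, Suc j))"
  have B1: "B1 \<in> carrier_mat n n" unfolding B1_def by auto
  have B1sym: "transpose_mat B1 = B1"
    using arg_cong[OF Bsym, of "\<lambda>M. M $$ (Suc _, Suc _)"] B
    by (intro eq_matI) (auto simp: B1_def, metis Bsym Suc_less_eq carrier_matD index_transpose_mat(1))
  have Bblock: "B = four_block_mat (mat 1 1 (\<lambda>_. e)) (0\<^sub>m 1 n) (0\<^sub>m n 1) B1"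
    using B Bi0 B0i by (intro eq_matI) (auto simp: B1_def four_block_mat_def Let_def)
  from Suc.IH[OF B1 B1sym] obtain V d where V: "V \<in> carrier_mat n n" "transpose_mat V * V = 1\<^sub>m n"
    "V * transpose_mat V = 1\<^sub>m n" "B1 = V * mat_diag n d * transpose_mat V" by blast
  define d' where "d' i = (case i of 0 \<Rightarrow> e | Suc j \<Rightarrow> d j)" for i
  define V' where "V' = four_block_mat (1\<^sub>m 1) (0\<^sub>m 1 n) (0\<^sub>m n 1) V"
  have V': "V' \<in> carrier_mat (Suc n) (Suc n)" unfolding V'_def using V(1)
    by (metis four_block_carrier_mat one_carrier_mat plus_1_eq_Suc)
  have tV': "transpose_mat V' = four_block_mat (1\<^sub>m 1) (0\<^sub>m 1 n) (0\<^sub>m n 1) (transpose_mat V)"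
    unfolding V'_def by (subst transpose_four_block_mat) (use V(1) in auto)
  have diag: "mat_diag (Suc n) d' = four_block_mat (mat 1 1 (\<lambda>_. e)) (0\<^sub>m 1 n) (0\<^sub>m n 1) (mat_diag n d)"
    by (intro eq_matI) (auto simp: four_block_mat_def Let_def mat_diag_def d'_def split: nat.split)
  have V'V': "transpose_mat V' * V' = 1\<^sub>m (Suc n)" "V' * transpose_mat V' = 1\<^sub>m (Suc n)"
    unfolding tV' unfolding V'_def
    using V by (simp_all add: block_diag_mult[where p=1 and q=n] plus_1_eq_Suc del: One_nat_def)
  have BV: "B = V' * mat_diag (Suc n) d' * transpose_mat V'"
    unfolding tV' unfolding V'_def diag Bblock V(4)
    using V(1) by (simp add: block_diag_mult[where p=1 and q=n] mult_carrier_mat[of _ n n _ n] del: One_nat_def)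
  define U where "U = W * V'"
  have U: "U \<in> carrier_mat (Suc n) (Suc n)" unfolding U_def using W V' by auto
  note simps = transpose_mult[of _ "Suc n" "Suc n" _ "Suc n"] 
    assoc_mult_mat[of _ "Suc n" "Suc n" _ "Suc n" _ "Suc n"]
    mult_carrier_mat[of _ "Suc n" "Suc n" _ "Suc n"]
  \<comment> \<open>Products are normalised to right-nested form, where the orthogonality relations
    occur only in front of a remaining factor \<open>X\<close>.\<close>
  have cancel: "transpose_mat W * (W * X) = X" "W * (transpose_mat W * X) = X"
    "transpose_mat V' * (V' * X) = X" "V' * (transpose_mat V' * X) = X"
    if "X \<in> carrier_mat (Suc n) (Suc n)" for X
    using that W V' WW V'V'
    by (metis assoc_mult_mat left_mult_one_mat transpose_carrier_mat)+
  have "transpose_mat U * U = 1\<^sub>m (Suc n)"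
    unfolding U_def using W V' by (simp add: simps cancel V'V')
  moreover have "U * transpose_mat U = 1\<^sub>m (Suc n)"
    unfolding U_def using W V' by (simp add: simps cancel WW)
  moreover have "A = U * mat_diag (Suc n) d' * transpose_mat U"
  proof -
    have "A = W * B * transpose_mat W"
      unfolding B_def using W A by (simp add: simps cancel WW)
    then show ?thesis
      unfolding BV U_def using W V' by (simp add: simps)
  qed
  ultimately show ?case using U by blast
qed

text \<open>Similar matrices share their characteristic polynomial, and that of a diagonal matrix
  splits into linear factors. This lets \<open>singular_values\<close> and \<open>eig_desc\<close>
  be read off from any spectral decomposition.\<close>

lemma eigenvalues_mset_orthogonal_diag:
  assumes U: "U \<in> carrier_mat n n" "transpose_mat U * U = 1\<^sub>m n" "U * transpose_mat U = 1\<^sub>m n"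
  shows "eigenvalues_mset (U * mat_diag n d * transpose_mat U) = image_mset d (mset_set {..<n})"
proof -
  let ?A = "U * mat_diag n d * transpose_mat U"
  have "similar_mat ?A (mat_diag n d)"
    unfolding similar_mat_def similar_mat_wit_def Let_def
    by (rule exI[of _ U], rule exI[of _ "transpose_mat U"]) (use U in \<open>auto simp: mult_carrier_mat[of _ n n]\<close>)
  then have "char_poly ?A = char_poly (mat_diag n d)" by (rule char_poly_similar)
  also have "\<dots> = (\<Prod>a\<leftarrow>diag_mat (mat_diag n d). [:- a, 1:])"
    by (rule char_poly_upper_triangular) (auto simp: mat_diag_def upper_triangular_def)
  also have "\<dots> = (\<Prod>i\<leftarrow>[0..<n]. [:- d i, 1:])"
    by (auto simp: diag_mat_def mat_diag_def comp_def intro!: arg_cong[of _ _ prod_list])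
  also have "\<dots> = (\<Prod>i<n. [:- d i, 1:])"
    by (simp add: prod.distinct_set_conv_list[symmetric] atLeast0LessThan)
  finally have "eigenvalues_mset ?A = (\<Sum>i<n. proots [:- d i, 1:])"
    unfolding eigenvalues_mset_def by (simp add: proots_prod)
  also have "\<dots> = (\<Sum>i<n. {#d i#})" by simp
  also have "\<dots> = image_mset d (mset_set {..<n})"
    by (induction n) (auto simp: lessThan_Suc)
  finally show ?thesis .
qed

section \<open>Traces and quadratic forms\<close>

definition mtrace :: "real mat \<Rightarrow> real" where
  "mtrace A = (\<Sum>i<dim_row A. A $$ (i,i))"

lemma mtrace_comm:
  assumes "A \<in> carrier_mat n m" "B \<in> carrier_mat m n"
  shows "mtrace (A * B) = mtrace (B * A)"
proof -
  have "mtrace (A * B) = (\<Sum>i<n. \<Sum>j<m. A $$ (i,j) * B $$ (j,i))"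
    using assms by (auto simp: mtrace_def scalar_prod_def atLeast0LessThan)
  also have "\<dots> = (\<Sum>j<m. \<Sum>i<n. B $$ (j,i) * A $$ (i,j))"
    by (subst sum.swap) (simp add: mult.commute)
  also have "\<dots> = mtrace (B * A)"
    using assms by (auto simp: mtrace_def scalar_prod_def atLeast0LessThan)
  finally show ?thesis .
qed

lemma mtrace_transpose: "A \<in> carrier_mat n n \<Longrightarrow> mtrace (transpose_mat A) = mtrace A"
  by (auto simp: mtrace_def)

lemma sandwich_index:
  assumes X: "X \<in> carrier_mat n k" and A: "A \<in> carrier_mat n l" and Y: "Y \<in> carrier_mat l q" 
    and "i < k" "j < q"
  shows "(transpose_mat X * A * Y) $$ (i,j) = col X i \<bullet> (A *\<^sub>v col Y j :: real vec)"
proof -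
  have "transpose_mat X * A * Y = transpose_mat X * (A * Y)"
    using assms by (intro assoc_mult_mat) auto
  then show ?thesis using assms by (simp add: mult_mat_vec_def)
qed

text \<open>It turns a trace into a sum of bilinear forms over columns, so that pointwise positivity
  can be summed to a trace inequality.\<close>

lemma mtrace_sandwich:
  assumes "X \<in> carrier_mat n k" "A \<in> carrier_mat n l" "Y \<in> carrier_mat l k"
  shows "mtrace (transpose_mat X * A * Y) = (\<Sum>j<k. col X j \<bullet> (A *\<^sub>v col Y j))"
  using assms sandwich_index[OF assms] by (simp add: mtrace_def)

lemma scalar_prod_ge_0_real: "0 \<le> v \<bullet> (v :: real vec)"
  by (simp add: scalar_prod_def sum_nonneg)

lemma scalar_prod_eq_0_real:
  assumes "v \<in> carrier_vec n"
  shows "v \<bullet> (v :: real vec) = 0 \<longleftrightarrow> v = 0\<^sub>v n"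
  using conjugate_square_eq_0_vec[OF assms] by (simp add: conjugate_vec_def)

lemma quadform_orthogonal_diag:
  fixes U :: "real mat"
  assumes U: "U \<in> carrier_mat n n" and v: "v \<in> carrier_vec n" and w: "w \<in> carrier_vec n"
  shows "w \<bullet> ((U * mat_diag n d * transpose_mat U) *\<^sub>v v) = (\<Sum>i<n. d i * (col U i \<bullet> w) * (col U i \<bullet> v))"
proof -
  have "w \<bullet> ((U * mat_diag n d * transpose_mat U) *\<^sub>v v) = w \<bullet> (U *\<^sub>v (mat_diag n d *\<^sub>v (transpose_mat U *\<^sub>v v)))"
    using U v by (simp add: assoc_mult_mat_vec[of _ n n _ n])
  also have "\<dots> = (transpose_mat U *\<^sub>v w) \<bullet> (mat_diag n d *\<^sub>v (transpose_mat U *\<^sub>v v))"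
    using transpose_vec_mult_scalar[OF U _ w] U v by (simp add: mult_mat_vec_carrier[of _ n n])
  also have "mat_diag n d *\<^sub>v x = vec n (\<lambda>i. d i * x $ i)" if "x \<in> carrier_vec n" for x :: "real vec"
    using that by (intro eq_vecI) (auto simp: mat_diag_def scalar_prod_def if_distrib[where f = "\<lambda>c. c * _"] sum.If_cases cong: if_cong)
  also have "(transpose_mat U *\<^sub>v w) \<bullet> (vec n (\<lambda>i. d i * (transpose_mat U *\<^sub>v v) $ i)) 
    = (\<Sum>i<n. d i * (col U i \<bullet> w) * (col U i \<bullet> v))"
    using U v w by (simp add: scalar_prod_def[of "transpose_mat U *\<^sub>v w"] atLeast0LessThan mult_ac)
  finally show ?thesis using U v by (simp add: mult_mat_vec_carrier[of _ n n])
qed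

lemma mtrace_orthogonal_diag:
  assumes U: "U \<in> carrier_mat n n" "transpose_mat U * U = 1\<^sub>m n"
  shows "mtrace (U * mat_diag n d * transpose_mat U) = (\<Sum>i<n. d i)"
proof -
  have "mtrace (U * mat_diag n d * transpose_mat U) = mtrace (transpose_mat U * (U * mat_diag n d))"
    by (rule mtrace_comm[of _ n n]) (use U in \<open>auto intro: mult_carrier_mat\<close>)
  also have "transpose_mat U * (U * mat_diag n d) = mat_diag n d"
    using U by (simp add: assoc_mult_mat[of _ n n _ n _ n, symmetric] left_mult_one_mat[of _ n n])
  finally show ?thesis by (simp add: mtrace_def mat_diag_def)
qed

lemma orthogonal_cols:
  assumes U: "U \<in> carrier_mat n n" "transpose_mat U * U = 1\<^sub>m n" and "i < n" "j < n"
  shows "col U i \<bullet> col U j = (if i = j then 1 else (0::real))"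
  using arg_cong[OF U(2), of "\<lambda>M. M $$ (i,j)"] assms(1,3,4) by simp

lemma orthogonal_diag_eigenvalue:
  assumes U: "U \<in> carrier_mat n n" "transpose_mat U * U = 1\<^sub>m n" and i: "i < n"
  shows "col U i \<bullet> ((U * mat_diag n d * transpose_mat U) *\<^sub>v col U i) = (d i :: real)"
proof -
  have c: "col U i \<in> carrier_vec n" using U by (metis carrier_matD(1) col_dim)
  show ?thesis
    unfolding quadform_orthogonal_diag[OF U(1) c c]
    using i by (subst sum.remove[of _ i]) (auto simp: orthogonal_cols[OF U])
qed

section \<open>Inverse square roots of positive definite matrices\<close>

text \<open>Symmetry is kept apart, so that the body agrees literally with the definiteness clause
  in \<open>inv_sqrt_mat\<close>.\<close>

definition pos_def :: "nat \<Rightarrow> real mat \<Rightarrow> bool" where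
  "pos_def n A \<longleftrightarrow> (\<forall>v\<in>carrier_vec n. v \<noteq> 0\<^sub>v n \<longrightarrow> v \<bullet> (A *\<^sub>v v) > 0)"

lemma pos_defD: "pos_def n A \<Longrightarrow> v \<in> carrier_vec n \<Longrightarrow> v \<noteq> 0\<^sub>v n \<Longrightarrow> v \<bullet> (A *\<^sub>v v) > 0"
  by (auto simp: pos_def_def)

lemma pos_def_nonneg:
  assumes "pos_def n A" "A \<in> carrier_mat n n" "v \<in> carrier_vec n" shows "v \<bullet> (A *\<^sub>v v) \<ge> 0"
  using assms by (cases "v = 0\<^sub>v n") (auto simp: pos_def_def less_imp_le)

lemma smult_mat_mult_vec: "dim_col A = dim_vec v \<Longrightarrow> (c \<cdot>\<^sub>m A) *\<^sub>v v = c \<cdot>\<^sub>v (A *\<^sub>v (v :: real vec))"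
  by (intro eq_vecI) auto

lemma pos_def_smult:
  assumes A: "A \<in> carrier_mat n n" "pos_def n A" and c: "0 < c"
  shows "pos_def n (c \<cdot>\<^sub>m A)"
  unfolding pos_def_def
proof (intro ballI impI)
  fix v :: "real vec" assume v: "v \<in> carrier_vec n" "v \<noteq> 0\<^sub>v n"
  have "A *\<^sub>v v \<in> carrier_vec n" using A v by auto
  then show "0 < v \<bullet> ((c \<cdot>\<^sub>m A) *\<^sub>v v)"
    using pos_defD[OF A(2) v] c v A by (simp add: smult_mat_mult_vec)
qed

text \<open>Uniqueness of the positive definite square root: with \<open>D = R - T\<close> one has
  \<open>R D = - D T\<close>, so \<open>tr (D R D) = - tr (D T D)\<close>, and both traces are nonnegative.\<close>

lemma pos_def_sqrt_unique:
  assumes R: "R \<in> carrier_mat n n" "transpose_mat R = R" "pos_def n R"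
    and T: "T \<in> carrier_mat n n" "transpose_mat T = T" "pos_def n T"
    and eq: "R * R = T * T"
  shows "R = T"
proof -
  define D where "D = R - T"
  have D: "D \<in> carrier_mat n n" and Dsym: "transpose_mat D = D"
    using R T by (auto simp: D_def transpose_minus[of _ n n])
  have c: "j < n \<Longrightarrow> col D j \<in> carrier_vec n" for j using D by (metis carrier_matD(1) col_dim)
  have "R * D = - (D * T)"
    using R T eq unfolding D_def
    by (intro eq_matI) (auto simp: mult_minus_distrib_mat[of _ n n] minus_mult_distrib_mat[of _ n n])
  then have "mtrace (R * D * D) = mtrace (- (D * T) * D)" by simp
  moreover have "mtrace (- (D * T) * D) = - mtrace (D * T * D)"
    using D T by (simp add: mtrace_def sum_negf)
  moreover have "mtrace (R * D * D) = mtrace (D * (R * D))"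
    by (rule mtrace_comm[of _ n n]) (use R D in auto)
  moreover have "D * (R * D) = D * R * D" using R D by (simp add: assoc_mult_mat[of _ n n _ n _ n])
  ultimately have "mtrace (D * R * D) + mtrace (D * T * D) = 0" by simp
  then have s0: "(\<Sum>j<n. col D j \<bullet> (R *\<^sub>v col D j)) + (\<Sum>j<n. col D j \<bullet> (T *\<^sub>v col D j)) = 0"
    using mtrace_sandwich[OF D R(1) D] mtrace_sandwich[OF D T(1) D] unfolding Dsym by simp
  have nR: "0 \<le> col D j \<bullet> (R *\<^sub>v col D j)" and nT: "0 \<le> col D j \<bullet> (T *\<^sub>v col D j)" if "j < n" for j
    using pos_def_nonneg R T c that by auto
  have sR: "0 \<le> (\<Sum>j<n. col D j \<bullet> (R *\<^sub>v col D j))" by (intro sum_nonneg) (simp add: nR)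
  have sT: "0 \<le> (\<Sum>j<n. col D j \<bullet> (T *\<^sub>v col D j))" by (intro sum_nonneg) (simp add: nT)
  have "(\<Sum>j<n. col D j \<bullet> (R *\<^sub>v col D j)) = 0"
    using s0 sR sT by linarith
  then have "col D j \<bullet> (R *\<^sub>v col D j) = 0" if "j < n" for j
    using nR that by (subst (asm) sum_nonneg_eq_0_iff) auto
  then have col0: "col D j = 0\<^sub>v n" if "j < n" for j
    using pos_defD[OF R(3) c] that by fastforce
  show ?thesis
  proof (rule eq_matI)
    fix i j assume "i < dim_row T" "j < dim_col T"
    then have "col D j $ i = 0" "i < n" "j < n" using col0 T by auto
    then show "R $$ (i,j) = T $$ (i,j)" using D R T by (auto simp: D_def)
  qed (use R T in auto)
qed

text \<open>In an eigenbasis of \<open>S\<close> the matrix acts by 1 / sqrt of each eigenvalue; the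
  eigenvalues are positive as values of the form of \<open>S\<close> at unit eigenvectors.\<close>

lemma inv_sqrt_mat_exists:
  assumes S: "S \<in> carrier_mat n n" "transpose_mat S = S" "pos_def n S"
  shows "\<exists>R. R \<in> carrier_mat n n \<and> transpose_mat R = R \<and> pos_def n R \<and> R * R * S = 1\<^sub>m n"
proof -
  obtain U d where U: "U \<in> carrier_mat n n" "transpose_mat U * U = 1\<^sub>m n" "U * transpose_mat U = 1\<^sub>m n"
    and SU: "S = U * mat_diag n d * transpose_mat U"
    using spectral_theorem_symmetric[OF S(1,2)] by blast
  have c: "i < n \<Longrightarrow> col U i \<in> carrier_vec n" for i using U by (metis carrier_matD(1) col_dim)
  have d: "d i > 0" if i: "i < n" for i
  proof -
    have "col U i \<noteq> 0\<^sub>v n" using orthogonal_cols[OF U(1,2) i i] c[OF i] by auto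
    then show ?thesis using orthogonal_diag_eigenvalue[OF U(1,2) i, of d] pos_defD[OF S(3) c[OF i]] SU by simp
  qed
  define e where "e i = 1 / sqrt (d i)" for i
  have e: "e i > 0" if "i < n" for i using d[OF that] by (simp add: e_def)
  define R where "R = U * mat_diag n e * transpose_mat U"
  note alg = assoc_mult_mat[of _ n n _ n _ n] mult_carrier_mat[of _ n n _ n] transpose_mult[of _ n n _ n]
  have R: "R \<in> carrier_mat n n" using U by (simp add: R_def alg)
  have "transpose_mat (mat_diag n e) = mat_diag n e" by (intro eq_matI) (auto simp: mat_diag_def)
  then have Rt: "transpose_mat R = R" using U(1) by (simp add: R_def alg)
  have cancel: "transpose_mat U * (U * X) = X" if "X \<in> carrier_mat n n" for X
    using that U by (simp add: assoc_mult_mat[of _ n n _ n _ n, symmetric])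
  have dd: "mat_diag n f * (mat_diag n g * X) = mat_diag n (\<lambda>i. f i * g i) * X" 
    if "X \<in> carrier_mat n n" for X and f g :: "nat \<Rightarrow> real"
    using that by (simp add: assoc_mult_mat[of _ n n _ n _ n, symmetric])
  have "e i * e i * d i = 1" if "i < n" for i using d[OF that] by (simp add: e_def field_simps)
  then have de: "mat_diag n (\<lambda>i. e i * e i * d i) = 1\<^sub>m n"
    by (intro eq_matI) (auto simp: mat_diag_def)
  have "R * R * S = U * (mat_diag n (\<lambda>i. e i * e i * d i) * transpose_mat U)"
    using U(1) by (simp add: R_def SU alg cancel dd)
  then have one: "R * R * S = 1\<^sub>m n"
    unfolding de using U by simp
  have "pos_def n R" unfolding pos_def_def
  proof (intro ballI impI)
    fix v :: "real vec" assume v: "v \<in> carrier_vec n" "v \<noteq> 0\<^sub>v n"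
    have q: "v \<bullet> (R *\<^sub>v v) = (\<Sum>i<n. e i * (col U i \<bullet> v)\<^sup>2)"
      unfolding R_def quadform_orthogonal_diag[OF U(1) v(1) v(1)] by (simp add: power2_eq_square mult.assoc)
    \<comment> \<open>An orthogonal matrix kills no nonzero vector, so at least one term of the
      nonnegative sum is strictly positive.\<close>
    have "\<exists>i<n. col U i \<bullet> v \<noteq> 0"
    proof (rule ccontr)
      assume "\<not> ?thesis"
      then have "transpose_mat U *\<^sub>v v = 0\<^sub>v n" using U v by (intro eq_vecI) auto
      then have "(U * transpose_mat U) *\<^sub>v v = 0\<^sub>v n" using U(1) v 
        by (simp add: assoc_mult_mat_vec[of _ n n _ n]) (auto intro!: eq_vecI simp: scalar_prod_def)
      then show False using v unfolding U(3) by simp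
    qed
    then obtain i where i: "i < n" "col U i \<bullet> v \<noteq> 0" by blast
    have "0 < e i * (col U i \<bullet> v)\<^sup>2" using e i by simp
    also have "\<dots> \<le> (\<Sum>i<n. e i * (col U i \<bullet> v)\<^sup>2)"
      by (rule member_le_sum) (use i e in \<open>auto simp: less_imp_le\<close>)
    finally show "0 < v \<bullet> (R *\<^sub>v v)" using q by simp
  qed
  then show ?thesis using R Rt one by blast
qed

text \<open>Two matrices fitting the definite description both square to the inverse of
  \<open>S\<close>, hence coincide by \<open>pos_def_sqrt_unique\<close>; so the properties of the
  existing one pass to \<open>inv_sqrt_mat\<close>.\<close>

lemma inv_sqrt_mat:
  assumes S: "S \<in> carrier_mat n n" "transpose_mat S = S" "pos_def n S"
  defines "R \<equiv> inv_sqrt_mat n S"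
  shows "R \<in> carrier_mat n n" "transpose_mat R = R" "pos_def n R" "R * R * S = 1\<^sub>m n"
proof -
  let ?P = "\<lambda>R. R \<in> carrier_mat n n \<and> transpose_mat R = R \<and> pos_def n R \<and> R * R * S = 1\<^sub>m n"
  obtain R0 where R0: "?P R0" using inv_sqrt_mat_exists[OF S] by blast
  have uniq: "X = R0" if X: "?P X" for X
  proof (rule pos_def_sqrt_unique)
    have "S * (R0 * R0) = 1\<^sub>m n"
      using mat_mult_left_right_inverse[of "R0 * R0" n S] R0 S(1) by (simp add: mult_carrier_mat[of _ n n _ n])
    then have "X * X * (S * (R0 * R0)) = X * X" using X by (simp add: mult_carrier_mat[of _ n n _ n] right_mult_one_mat[of _ n n])
    moreover have "X * X * (S * (R0 * R0)) = R0 * R0"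
      using X R0 S(1) by (simp add: assoc_mult_mat[of "X * X" n n S n "R0 * R0" n, symmetric] mult_carrier_mat[of _ n n _ n] left_mult_one_mat[of _ n n])
    ultimately show "X * X = R0 * R0" by simp
  qed (use X R0 in auto)
  have "?P (THE R. ?P R)" using theI[of ?P R0] R0 uniq by blast
  moreover have "R = (THE R. ?P R)" unfolding R_def inv_sqrt_mat_def pos_def_def ..
  ultimately show "R \<in> carrier_mat n n" "transpose_mat R = R" "pos_def n R" "R * R * S = 1\<^sub>m n"
    by simp_all
qed

text \<open>The witness \<open>R * S\<close> is S^(1/2), obtained without a second diagonalisation.
  It is symmetric because transposing \<open>R * W = 1\<close> shows its transpose to be an inverse
  of \<open>R\<close> too.\<close>

lemma inv_sqrt_mat_inverse:
  assumes S: "S \<in> carrier_mat n n" "transpose_mat S = S" "pos_def n S"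
  defines "R \<equiv> inv_sqrt_mat n S"
  shows "\<exists>W. W \<in> carrier_mat n n \<and> transpose_mat W = W \<and> W * R = 1\<^sub>m n \<and> R * W = 1\<^sub>m n \<and> W * W = S"
proof -
  note R = inv_sqrt_mat[OF S, folded R_def]
  define W where "W = R * S"
  note alg = assoc_mult_mat[of _ n n _ n _ n] mult_carrier_mat[of _ n n _ n] transpose_mult[of _ n n _ n]
  have W: "W \<in> carrier_mat n n" using R(1) S(1) by (simp add: W_def alg)
  have RW: "R * W = 1\<^sub>m n" using R(4) by (simp add: W_def assoc_mult_mat[OF R(1) R(1) S(1)])
  have WR: "W * R = 1\<^sub>m n" by (rule mat_mult_left_right_inverse[OF R(1) W RW])
  have tW: "transpose_mat W * R = 1\<^sub>m n"
    using arg_cong[OF RW, of transpose_mat] by (simp add: transpose_mult[OF R(1) W] R(2))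
  have "transpose_mat W = transpose_mat W * (R * W)" unfolding RW using W by simp
  also have "\<dots> = transpose_mat W * R * W" using assoc_mult_mat[OF _ R(1) W] W by simp
  also have "\<dots> = W" unfolding tW using W by simp
  finally have Wt: "transpose_mat W = W" .
  have "W * W = W * (R * S)" by (simp add: W_def)
  also have "\<dots> = W * R * S" using assoc_mult_mat[OF W R(1) S(1)] by simp
  finally have "W * W = S" unfolding WR using S(1) by simp
  then show ?thesis using W Wt WR RW by blast
qed

section \<open>Whitened cross-covariances and the trace inequality\<close>

lemma scalar_prod_symmetric_mat:
  assumes "R \<in> carrier_mat n n" "transpose_mat R = R" "v \<in> carrier_vec n" "w \<in> carrier_vec n"
  shows "(R *\<^sub>v v) \<bullet> w = v \<bullet> (R *\<^sub>v w :: real vec)"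
  using transpose_vec_mult_scalar[OF assms(1,4,3)] assms(2) by simp

lemma mtrace_mult_orthogonal_diag:
  assumes U: "U \<in> carrier_mat n n" and B: "B \<in> carrier_mat m n"
  shows "mtrace (transpose_mat B * B * (U * mat_diag n d * transpose_mat U)) = 
    (\<Sum>i<n. d i * ((B *\<^sub>v col U i) \<bullet> (B *\<^sub>v col U i)))"
proof -
  define X where "X = B * U"
  have X: "X \<in> carrier_mat m n" using U B by (simp add: X_def)
  have "transpose_mat B * B * (U * mat_diag n d * transpose_mat U) 
      = (transpose_mat B * X * mat_diag n d) * transpose_mat U"
    using U B by (simp add: X_def assoc_mult_mat[of _ n n _ n _ n] assoc_mult_mat[of _ n m _ n _ n] 
      assoc_mult_mat[of _ m n _ n _ n] mult_carrier_mat[of _ n n _ n] mult_carrier_mat[of _ m n _ n])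
  then have "mtrace (transpose_mat B * B * (U * mat_diag n d * transpose_mat U))
      = mtrace (transpose_mat U * (transpose_mat B * X * mat_diag n d))"
    using mtrace_comm[of "transpose_mat B * X * mat_diag n d" n n "transpose_mat U"] U B X
    by (simp add: mult_carrier_mat[of _ n n _ n] mult_carrier_mat[of _ n m _ n])
  also have "transpose_mat U * (transpose_mat B * X * mat_diag n d) = transpose_mat X * X * mat_diag n d"
    using U B by (simp add: X_def transpose_mult[OF B U] assoc_mult_mat[of _ n n _ n _ n] assoc_mult_mat[of _ n m _ n _ n] 
      assoc_mult_mat[of _ n n _ m _ n] assoc_mult_mat[of _ m n _ n _ n] mult_carrier_mat[of _ n n _ n] mult_carrier_mat[of _ m n _ n] mult_carrier_mat[of _ n m _ n])
  also have "mtrace (transpose_mat X * X * mat_diag n d) = (\<Sum>i<n. (col X i \<bullet> col X i) * d i)"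
    using X by (simp add: mtrace_def mat_diag_mult_right[of _ n n] mult_carrier_mat[of _ n m _ n])
  finally show ?thesis
    using col_mult2[OF B U] by (simp add: X_def mult.commute)
qed

text \<open>In the eigenbasis of \<open>Z\<close> the right side is the sum of d_i (1 - b_i), with
  b_i the squared length of the image of the i-th eigenvector under \<open>B\<close>. Since b_i <= 1
  and d_i >= \<open>\<mu>\<close>, each d_i may be replaced by \<open>\<mu>\<close>.\<close>

lemma mtrace_mult_lower_bound:
  assumes Z: "Z \<in> carrier_mat n n" "transpose_mat Z = Z" 
    and lower: "\<And>v. v \<in> carrier_vec n \<Longrightarrow> \<mu> * (v \<bullet> v) \<le> v \<bullet> (Z *\<^sub>v v)"
    and B: "B \<in> carrier_mat m n"
    and contr: "\<And>v. v \<in> carrier_vec n \<Longrightarrow> (B *\<^sub>v v) \<bullet> (B *\<^sub>v v) \<le> v \<bullet> v"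
  shows "\<mu> * (real n - mtrace (transpose_mat B * B)) \<le> mtrace Z - mtrace (transpose_mat B * B * Z)"
proof -
  obtain U d where U: "U \<in> carrier_mat n n" "transpose_mat U * U = 1\<^sub>m n" "U * transpose_mat U = 1\<^sub>m n"
    and ZU: "Z = U * mat_diag n d * transpose_mat U"
    using spectral_theorem_symmetric[OF Z] by blast
  have c: "i < n \<Longrightarrow> col U i \<in> carrier_vec n" for i using U by (metis carrier_matD(1) col_dim)
  define b where "b i = (B *\<^sub>v col U i) \<bullet> (B *\<^sub>v col U i)" for i
  \<comment> \<open>With all eigenvalues set to 1 the spectral form is the identity, so the same
    expansion computes this trace in the eigenbasis of \<open>Z\<close>.\<close>
  have "mtrace (transpose_mat B * B) = mtrace (transpose_mat B * B * (U * mat_diag n (\<lambda>_. 1) * transpose_mat U))"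
    using U B by (simp add: mult_carrier_mat[of _ n m _ n] right_mult_one_mat[of _ n n])
  then have trB: "mtrace (transpose_mat B * B) = (\<Sum>i<n. b i)"
    unfolding mtrace_mult_orthogonal_diag[OF U(1) B] b_def by simp
  have "\<mu> * (1 - b i) \<le> d i * (1 - b i)" if i: "i < n" for i
  proof (rule mult_right_mono)
    show "\<mu> \<le> d i" using lower[OF c[OF i]] orthogonal_diag_eigenvalue[OF U(1,2) i, of d]
      unfolding ZU by (simp add: orthogonal_cols[OF U(1,2) i i])
    show "0 \<le> 1 - b i" using contr[OF c[OF i]] by (simp add: b_def orthogonal_cols[OF U(1,2) i i])
  qed
  then have "(\<Sum>i<n. \<mu> * (1 - b i)) \<le> (\<Sum>i<n. d i * (1 - b i))" by (intro sum_mono) auto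
  moreover have "(\<Sum>i<n. \<mu> * (1 - b i)) = \<mu> * (real n - mtrace (transpose_mat B * B))"
    unfolding trB by (simp add: sum_distrib_left[symmetric] sum_subtractf)
  moreover have "(\<Sum>i<n. d i * (1 - b i)) = mtrace Z - mtrace (transpose_mat B * B * Z)"
    unfolding ZU mtrace_mult_orthogonal_diag[OF U(1) B] mtrace_orthogonal_diag[OF U(1,2)] b_def
    by (simp add: right_diff_distrib sum_subtractf)
  ultimately show ?thesis by simp
qed

text \<open>The \<open>d i\<close> are the squared singular values; contraction confines them to
  [0,1], where a number is at most its square root.\<close>

lemma sum_singular_values_ge_mtrace:
  assumes K: "K \<in> carrier_mat n n"
    and contr: "\<And>v. v \<in> carrier_vec n \<Longrightarrow> (K *\<^sub>v v) \<bullet> (K *\<^sub>v v) \<le> v \<bullet> v"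
  shows "mtrace (transpose_mat K * K) \<le> sum_mset (singular_values K)"
proof -
  let ?A = "transpose_mat K * K"
  have A: "?A \<in> carrier_mat n n" "transpose_mat ?A = ?A" using K by (simp_all add: transpose_mult[of _ n n _ n])
  obtain U d where U: "U \<in> carrier_mat n n" "transpose_mat U * U = 1\<^sub>m n" "U * transpose_mat U = 1\<^sub>m n"
    and AU: "?A = U * mat_diag n d * transpose_mat U"
    using spectral_theorem_symmetric[OF A] by blast
  have c: "i < n \<Longrightarrow> col U i \<in> carrier_vec n" for i using U by (metis carrier_matD(1) col_dim)
  have d: "d i \<le> sqrt (d i)" if i: "i < n" for i
  proof -
    have "d i = col U i \<bullet> (?A *\<^sub>v col U i)"
      using orthogonal_diag_eigenvalue[OF U(1,2) i, of d] AU by simp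
    also have "\<dots> = col U i \<bullet> (transpose_mat K *\<^sub>v (K *\<^sub>v col U i))"
      using K c[OF i] by (simp add: assoc_mult_mat_vec[of _ n n _ n])
    also have "\<dots> = (K *\<^sub>v col U i) \<bullet> (K *\<^sub>v col U i)"
      using transpose_vec_mult_scalar[of "transpose_mat K" n n "K *\<^sub>v col U i" "col U i"] K c[OF i] by simp
    finally have di: "d i = (K *\<^sub>v col U i) \<bullet> (K *\<^sub>v col U i)" .
    have d1: "d i \<le> 1" using contr[OF c[OF i]] unfolding di by (simp add: orthogonal_cols[OF U(1,2) i i])
    have d0: "0 \<le> d i" unfolding di by (rule scalar_prod_ge_0_real)
    have "d i * d i \<le> d i" using d0 d1 by (simp add: mult_left_le)
    then show ?thesis by (intro real_le_rsqrt) (simp add: power2_eq_square)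
  qed
  have "mtrace ?A = (\<Sum>i<n. d i)" unfolding AU mtrace_orthogonal_diag[OF U(1,2)] ..
  also have "\<dots> \<le> (\<Sum>i<n. sqrt (d i))" by (intro sum_mono) (simp add: d)
  also have "\<dots> = sum_mset (singular_values K)"
    unfolding singular_values_def AU eigenvalues_mset_orthogonal_diag[OF U]
    by (simp add: sum_unfold_sum_mset image_mset.compositionality comp_def)
  finally show ?thesis .
qed

text \<open>Positive semidefiniteness of the block matrix with rows (S, C) and (C^T, S'), when
  \<open>S\<close> and \<open>S'\<close> are symmetric. As a form in two free vectors it needs no
  block matrix, and replacing \<open>a\<close> by \<open>- a\<close> flips the sign of the cross
  term.\<close>

definition joint_psd :: "nat \<Rightarrow> real mat \<Rightarrow> real mat \<Rightarrow> real mat \<Rightarrow> bool" where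
  "joint_psd n S C S' \<longleftrightarrow> (\<forall>a\<in>carrier_vec n. \<forall>b\<in>carrier_vec n. 
     0 \<le> a \<bullet> (S *\<^sub>v a) + 2 * (a \<bullet> (C *\<^sub>v b)) + b \<bullet> (S' *\<^sub>v b))"

text \<open>Substituting the whitened vectors turns the joint form into |a|^2 + 2 a.Kb + |b|^2. The
  choices (a, b) = (-Kv, v) and (v, -K^T v) give the two bounds. Contraction of \<open>K\<close>
  controls the singular values, that of its transpose the residual variance.\<close>

lemma whitened_cross_contraction:
  assumes S: "S \<in> carrier_mat n n" "transpose_mat S = S" "pos_def n S"
    and S': "S' \<in> carrier_mat n n" "transpose_mat S' = S'" "pos_def n S'"
    and C: "C \<in> carrier_mat n n"
    and joint: "joint_psd n S C S'"
  defines "K \<equiv> inv_sqrt_mat n S * C * inv_sqrt_mat n S'"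
  assumes v: "v \<in> carrier_vec n"
  shows "(K *\<^sub>v v) \<bullet> (K *\<^sub>v v) \<le> v \<bullet> v"
    and "(transpose_mat K *\<^sub>v v) \<bullet> (transpose_mat K *\<^sub>v v) \<le> v \<bullet> v"
proof -
  have white: "(inv_sqrt_mat n S *\<^sub>v a) \<bullet> (S *\<^sub>v (inv_sqrt_mat n S *\<^sub>v a)) = a \<bullet> a"
    if S: "S \<in> carrier_mat n n" "transpose_mat S = S" "pos_def n S" and a: "a \<in> carrier_vec n" for S and a :: "real vec"
  proof -
    let ?R = "inv_sqrt_mat n S"
    note R = inv_sqrt_mat[OF S]
    obtain W where W: "W \<in> carrier_mat n n" "W * ?R = 1\<^sub>m n" "?R * W = 1\<^sub>m n" "W * W = S"
      using inv_sqrt_mat_inverse[OF S] by blast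
    have "?R * (S * ?R) = ?R * W * (W * ?R)" using R(1) W(1) 
      unfolding W(4)[symmetric] by (simp add: assoc_mult_mat[of _ n n _ n _ n] mult_carrier_mat[of _ n n _ n])
    then have one: "?R * (S * ?R) = 1\<^sub>m n" using W by simp
    have "(?R *\<^sub>v a) \<bullet> (S *\<^sub>v (?R *\<^sub>v a)) = a \<bullet> ((?R * (S * ?R)) *\<^sub>v a)"
      using R(1) S(1) a by (simp add: scalar_prod_symmetric_mat[OF R(1,2)] assoc_mult_mat_vec[of _ n n _ n] 
        mult_carrier_mat[of _ n n _ n] mult_mat_vec_carrier[of _ n n])
    then show ?thesis using a by (simp add: one)
  qed
  let ?R = "inv_sqrt_mat n S" and ?R' = "inv_sqrt_mat n S'"
  note R = inv_sqrt_mat[OF S] and R' = inv_sqrt_mat[OF S']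
  have K: "K \<in> carrier_mat n n" using R(1) R'(1) C unfolding K_def by simp
  have whitened: "0 \<le> a \<bullet> a + 2 * (a \<bullet> (K *\<^sub>v b)) + b \<bullet> b" 
    if a: "a \<in> carrier_vec n" and b: "b \<in> carrier_vec n" for a b
  proof -
    have ab: "?R *\<^sub>v a \<in> carrier_vec n" "?R' *\<^sub>v b \<in> carrier_vec n"
      using R(1) R'(1) a b by (auto intro: mult_mat_vec_carrier)
    have "(?R *\<^sub>v a) \<bullet> (C *\<^sub>v (?R' *\<^sub>v b)) = a \<bullet> (K *\<^sub>v b)"
      unfolding K_def using R(1) R'(1) C a b by (simp add: scalar_prod_symmetric_mat[OF R(1,2)] assoc_mult_mat_vec[of _ n n _ n] 
        mult_carrier_mat[of _ n n _ n] mult_mat_vec_carrier[of _ n n])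
    then show ?thesis
      using joint ab unfolding joint_psd_def by (metis white[OF S a] white[OF S' b])
  qed
  have KT: "(transpose_mat K *\<^sub>v a) \<bullet> b = a \<bullet> (K *\<^sub>v b)" 
    if "a \<in> carrier_vec n" "b \<in> carrier_vec n" for a b
    using transpose_vec_mult_scalar[OF K that(2,1)] .
  have c: "K *\<^sub>v v \<in> carrier_vec n" "transpose_mat K *\<^sub>v v \<in> carrier_vec n" 
    using K v by (auto intro: mult_mat_vec_carrier)
  show "(K *\<^sub>v v) \<bullet> (K *\<^sub>v v) \<le> v \<bullet> v"
    using whitened[of "- (K *\<^sub>v v)" v] c v by simp
  have "0 \<le> v \<bullet> v + 2 * (v \<bullet> (K *\<^sub>v (- (transpose_mat K *\<^sub>v v)))) + (- (transpose_mat K *\<^sub>v v)) \<bullet> (- (transpose_mat K *\<^sub>v v))"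
    using whitened[of v "- (transpose_mat K *\<^sub>v v)"] c v by simp
  also have "v \<bullet> (K *\<^sub>v (- (transpose_mat K *\<^sub>v v))) = (transpose_mat K *\<^sub>v v) \<bullet> (- (transpose_mat K *\<^sub>v v))"
    by (rule KT[symmetric]) (use v c in auto)
  finally show "(transpose_mat K *\<^sub>v v) \<bullet> (transpose_mat K *\<^sub>v v) \<le> v \<bullet> v"
    using c by simp
qed

text \<open>Pairing the joint form of \<open>T, -D, T'\<close> with the positive semidefinite rank-\<open>n\<close> part
  \<open>(C R', S' R') (C R', S' R')\<^sup>T\<close> of the joint matrix of \<open>S, C, S'\<close> leaves the Schur complement
  \<open>S - C S'\<^sup>-\<^sup>1 C\<^sup>T = W (1 - K K\<^sup>T) W\<close>, where \<open>W = S\<^sup>1\<^sup>/\<^sup>2\<close> and \<open>K = R C R'\<close>.\<close>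

lemma cross_trace_lower_bound:
  assumes S: "S \<in> carrier_mat n n" "transpose_mat S = S" "pos_def n S"
    and S': "S' \<in> carrier_mat n n" "transpose_mat S' = S'" "pos_def n S'"
    and C: "C \<in> carrier_mat n n" and joint: "joint_psd n S C S'"
    and T: "T \<in> carrier_mat n n" "transpose_mat T = T" and T': "T' \<in> carrier_mat n n"
    and D: "D \<in> carrier_mat n n" and jointT: "joint_psd n T D T'"
  defines "R \<equiv> inv_sqrt_mat n S"
  assumes lower: "\<And>v. v \<in> carrier_vec n \<Longrightarrow> \<mu> * ((R *\<^sub>v v) \<bullet> (R *\<^sub>v v)) \<le> v \<bullet> (T *\<^sub>v v)"
    and \<mu>: "0 < \<mu>"
  shows "\<mu> * (real n - sum_mset (singular_values (R * C * inv_sqrt_mat n S')))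
    \<le> mtrace (S * T) + mtrace (S' * T') - 2 * mtrace (transpose_mat C * D)"
proof -
  define R' where "R' = inv_sqrt_mat n S'"
  define K where "K = R * C * R'"
  note R = inv_sqrt_mat[OF S, folded R_def] and R' = inv_sqrt_mat[OF S', folded R'_def]
  obtain W where W: "W \<in> carrier_mat n n" "transpose_mat W = W" "W * R = 1\<^sub>m n" "R * W = 1\<^sub>m n" "W * W = S"
    using inv_sqrt_mat_inverse[OF S, folded R_def] by blast
  obtain W' where W': "W' \<in> carrier_mat n n" "transpose_mat W' = W'" "W' * R' = 1\<^sub>m n" "R' * W' = 1\<^sub>m n" "W' * W' = S'"
    using inv_sqrt_mat_inverse[OF S', folded R'_def] by blast
  note alg = assoc_mult_mat[of _ n n _ n _ n] mult_carrier_mat[of _ n n _ n] transpose_mult[of _ n n _ n]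
    left_mult_one_mat[of _ n n] right_mult_one_mat[of _ n n]
  note contr = whitened_cross_contraction[OF S S' C joint, folded R_def R'_def, folded K_def]
  have K: "K \<in> carrier_mat n n" using R(1) R'(1) C by (simp add: K_def alg)
  define X where "X = C * R'"
  have X: "X \<in> carrier_mat n n" using R'(1) C by (simp add: X_def alg)
  have WK: "X = W * K"
  proof -
    have "W * K = W * R * C * R'"
      using assoc_mult_mat[of W n n "R * C" n R' n] assoc_mult_mat[of W n n R n C n] R(1) R'(1) C W(1)
      by (simp add: K_def)
    then show ?thesis using C by (simp add: W(3) X_def alg(4))
  qed

  \<comment> \<open>The form of \<open>T\<close>, \<open>D\<close>, \<open>T'\<close> is tested at
    the columns of (-X, W'), where \<open>W'\<close> is S'^(1/2) = S' R'. In the resulting traces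
    \<open>W'\<close> either squares to \<open>S'\<close> or cancels against the factor
    \<open>R'\<close> of \<open>X\<close>, and \<open>X = W * K\<close> produces K K^T.\<close>
  have "0 \<le> (\<Sum>j<n. col X j \<bullet> (T *\<^sub>v col X j) - 2 * (col X j \<bullet> (D *\<^sub>v col W' j)) + col W' j \<bullet> (T' *\<^sub>v col W' j))"
  proof (rule sum_nonneg)
    fix j assume "j \<in> {..<n}"
    have c: "col X j \<in> carrier_vec n" "col W' j \<in> carrier_vec n" using X W' by (metis carrier_matD(1) col_dim)+
    have m: "D *\<^sub>v col W' j \<in> carrier_vec n" "T *\<^sub>v col X j \<in> carrier_vec n" using D T(1) c by auto
    have neg: "T *\<^sub>v (- col X j) = - (T *\<^sub>v col X j)" using T(1) c by (intro eq_vecI) (auto simp: scalar_prod_def sum_negf)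
    show "0 \<le> col X j \<bullet> (T *\<^sub>v col X j) - 2 * (col X j \<bullet> (D *\<^sub>v col W' j)) + col W' j \<bullet> (T' *\<^sub>v col W' j)"
      using jointT[unfolded joint_psd_def, rule_format, of "- col X j" "col W' j"] c neg X D T(1) by simp
  qed
  then have "0 \<le> mtrace (transpose_mat X * T * X) - 2 * mtrace (transpose_mat X * D * W') + mtrace (transpose_mat W' * T' * W')"
    using mtrace_sandwich[OF X T(1) X] mtrace_sandwich[OF X D W'(1)] mtrace_sandwich[OF W'(1) T' W'(1)]
    by (simp add: sum.distrib sum_subtractf sum_distrib_left)
  moreover have "mtrace (transpose_mat W' * T' * W') = mtrace (S' * T')"
  proof -
    have "mtrace (transpose_mat W' * T' * W') = mtrace (W' * (W' * T'))"
      unfolding W'(2) using mtrace_comm[of "W' * T'" n n W'] W'(1) T' by (simp add: alg)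
    also have "W' * (W' * T') = S' * T'"
      using W'(1) T' by (simp add: assoc_mult_mat[of _ n n _ n _ n, symmetric] W'(5))
    finally show ?thesis .
  qed
  moreover have "mtrace (transpose_mat X * D * W') = mtrace (transpose_mat C * D)"
  proof -
    have "transpose_mat X * D * W' = R' * (transpose_mat C * D * W')"
      unfolding X_def using C R' D W'(1) by (simp add: alg)
    then have "mtrace (transpose_mat X * D * W') = mtrace (transpose_mat C * D * W' * R')"
      using mtrace_comm[of R' n n "transpose_mat C * D * W'"] C R'(1) D W'(1) by (simp add: alg)
    also have "transpose_mat C * D * W' * R' = transpose_mat C * D"
      using C R'(1) D W'(1) by (simp add: alg W'(3))
    finally show ?thesis .
  qed
  moreover have "mtrace (transpose_mat X * T * X) = mtrace (K * transpose_mat K * (W * T * W))"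
  proof -
    have "transpose_mat X * T * X = transpose_mat K * (W * T * W * K)"
      unfolding WK using K W(1,2) T(1) by (simp add: alg)
    then have "mtrace (transpose_mat X * T * X) = mtrace (W * T * W * (K * transpose_mat K))"
      using mtrace_comm[of "transpose_mat K" n n "W * T * W * K"] K W(1) T(1) by (simp add: alg)
    also have "\<dots> = mtrace (K * transpose_mat K * (W * T * W))"
      by (rule mtrace_comm[of _ n n]) (use K W(1) T(1) in \<open>simp_all add: alg\<close>)
    finally show ?thesis .
  qed
  moreover have "mtrace (S * T) = mtrace (W * T * W)"
  proof -
    have "mtrace (S * T) = mtrace (W * (W * T))" using W(1) T(1) by (simp add: W(5)[symmetric] alg)
    also have "\<dots> = mtrace (W * T * W)" by (rule mtrace_comm[of _ n n]) (use W(1) T(1) in \<open>simp_all add: alg\<close>)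
    finally show ?thesis .
  qed
  \<comment> \<open>Here \<open>B\<close> is the transpose of \<open>K\<close> and \<open>Z\<close>
    is \<open>W * T * W\<close>. The hypothesis \<open>lower\<close>, evaluated at
    \<open>W *\<^sub>v v\<close>, says that \<open>Z\<close> is at least \<open>\<mu>\<close> times
    the identity, because \<open>R\<close> undoes \<open>W\<close>.\<close>
  moreover have "\<mu> * (real n - mtrace (transpose_mat (transpose_mat K) * transpose_mat K)) 
    \<le> mtrace (W * T * W) - mtrace (transpose_mat (transpose_mat K) * transpose_mat K * (W * T * W))"
  proof (rule mtrace_mult_lower_bound)
    fix v :: "real vec" assume v: "v \<in> carrier_vec n"
    have Wv: "W *\<^sub>v v \<in> carrier_vec n" using W(1) v by auto
    have "R *\<^sub>v (W *\<^sub>v v) = v" using R(1) W(1) v by (simp add: assoc_mult_mat_vec[of _ n n _ n, symmetric] W(4))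
    moreover have "v \<bullet> (W * T * W *\<^sub>v v) = (W *\<^sub>v v) \<bullet> (T *\<^sub>v (W *\<^sub>v v))"
      using W(1) T(1) v by (simp add: scalar_prod_symmetric_mat[OF W(1,2)] assoc_mult_mat_vec[of _ n n _ n] 
        mult_carrier_mat[of _ n n _ n] mult_mat_vec_carrier[of _ n n])
    ultimately show "\<mu> * (v \<bullet> v) \<le> v \<bullet> (W * T * W *\<^sub>v v)" using lower[OF Wv] by simp
  qed (use contr(2) W(1,2) T K in \<open>simp_all add: alg\<close>)
  \<comment> \<open>The regression argument yields K K^T, whereas \<open>singular_values\<close> is
    defined through K^T K.\<close>
  moreover have "mtrace (K * transpose_mat K) = mtrace (transpose_mat K * K)"
    using K by (intro mtrace_comm[of _ n n]) auto
  moreover have "\<mu> * (real n - sum_mset (singular_values K)) \<le> \<mu> * (real n - mtrace (transpose_mat K * K))"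
    using sum_singular_values_ge_mtrace[OF K contr(1)] \<mu> by simp
  ultimately show ?thesis unfolding K_def R'_def by simp
qed

section \<open>Eigenvalues of Gram matrices\<close>

text \<open>A maximal independent set of columns has m elements and therefore spans R^m. A vector
  orthogonal to every column is then orthogonal to itself.\<close>

lemma full_row_rank_transpose_kernel:
  fixes L :: "real mat"
  assumes L: "L \<in> carrier_mat m k" and rank: "vec_space.rank m L = m"
    and v: "v \<in> carrier_vec m" "transpose_mat L *\<^sub>v v = 0\<^sub>v k"
  shows "v = 0\<^sub>v m"
proof -
  interpret vec_space "TYPE(real)" m .
  let ?P = "\<lambda>T. T \<subseteq> set (cols L) \<and> lin_indpt T"
  have cc: "set (cols L) \<subseteq> carrier_vec m" using L cols_dim by blast
  have "\<exists>S. finite S \<and> maximal S ?P \<and> {} \<subseteq> S"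
    by (rule maximal_exists_superset[of "set (cols L)"]) (auto simp: lin_dep_def)
  then obtain S where S: "finite S" "maximal S ?P" by blast
  have card: "card S = m" using rank_card_indpt[OF L S(2)] rank by simp
  have SP: "S \<subseteq> set (cols L)" "lin_indpt S" using S(2) by (auto simp: maximal_def)
  have "basis S"
    by (rule dim_li_is_basis) (use S(1) SP cc card in \<open>auto simp: dim_is_n\<close>)
  then have "span S = carrier_vec m" by (simp add: basis_def)
  then have "v \<in> span (set (cols L))" using span_is_monotone[OF SP(1)] v(1) by auto
  moreover have "v \<in> orthogonal_complement (set (cols L))"
    unfolding orthogonal_complement_def
  proof (intro CollectI conjI ballI)
    fix y assume "y \<in> set (cols L)"
    then obtain j where j: "j < k" "y = col L j" using L by (auto simp: cols_def)
    then have "(transpose_mat L *\<^sub>v v) $ j = y \<bullet> v" using L by simp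
    then have "y \<bullet> v = 0" using v(2) j by simp
    then show "v \<bullet> y = 0" using comm_scalar_prod[OF v(1), of y] cc \<open>y \<in> set (cols L)\<close> by auto
  qed (rule v(1))
  ultimately have "v \<bullet> v = 0"
    using in_orthogonal_complement_span[OF cc] by (auto simp: orthogonal_complement_def)
  then show ?thesis using scalar_prod_eq_0_real[OF v(1)] by simp
qed

text \<open>A diagonal entry p of an orthogonal projection is the squared norm of its row, hence at
  least p^2. Summed over the diagonal, this bounds the trace of a projection by the
  dimension.\<close>

lemma symmetric_idempotent_diag_le_1:
  assumes P: "P \<in> carrier_mat n n" "transpose_mat P = P" "P * P = P" and j: "j < n"
  shows "P $$ (j,j) \<le> (1::real)"
proof -
  have sym: "P $$ (i,j) = P $$ (j,i)" if "i < n" for i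
    using arg_cong[OF P(2), of "\<lambda>M. M $$ (j,i)"] P(1) j that by simp
  have "P $$ (j,j) = (P * P) $$ (j,j)" using P(3) by simp
  also have "\<dots> = (\<Sum>i<n. P $$ (j,i) * P $$ (i,j))"
    using P(1) j by (simp add: scalar_prod_def atLeast0LessThan)
  also have "\<dots> = (\<Sum>i<n. (P $$ (j,i))\<^sup>2)" by (simp add: sym power2_eq_square)
  also have "\<dots> \<ge> (P $$ (j,j))\<^sup>2"
    by (rule member_le_sum[of j "{..<n}" "\<lambda>i. (P $$ (j,i))\<^sup>2"]) (use j in auto)
  finally have "P $$ (j,j) * P $$ (j,j) \<le> P $$ (j,j)" by (simp add: power2_eq_square)
  moreover have "P $$ (j,j) * 1 < P $$ (j,j) * P $$ (j,j)" if "1 < P $$ (j,j)"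
    using that by (intro mult_strict_left_mono) auto
  ultimately show ?thesis by fastforce
qed

text \<open>The normalised images of the eigenvectors with nonzero eigenvalue are orthonormal in \<open>\<real>\<^sup>m\<close>.\<close>

lemma card_nonzero_eigenvalues_gram_le:
  fixes d :: "nat \<Rightarrow> real"
  assumes B: "B \<in> carrier_mat m k"
    and U: "U \<in> carrier_mat k k" "transpose_mat U * U = 1\<^sub>m k"
    and BU: "transpose_mat B * B = U * mat_diag k d * transpose_mat U"
  shows "card {i. i < k \<and> d i \<noteq> 0} \<le> m"
proof -
  have c: "i < k \<Longrightarrow> col U i \<in> carrier_vec k" for i using U by (metis carrier_matD(1) col_dim)
  have d: "0 \<le> d i" if i: "i < k" for i
  proof -
    have "d i = col U i \<bullet> ((transpose_mat B * B) *\<^sub>v col U i)"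
      using orthogonal_diag_eigenvalue[OF U i, of d] BU by simp
    also have "\<dots> = col U i \<bullet> (transpose_mat B *\<^sub>v (B *\<^sub>v col U i))"
      using B c[OF i] by (simp add: assoc_mult_mat_vec[of _ k m _ k])
    also have "\<dots> = (B *\<^sub>v col U i) \<bullet> (B *\<^sub>v col U i)"
      using transpose_vec_mult_scalar[of "transpose_mat B" k m "B *\<^sub>v col U i" "col U i"] B c[OF i] by simp
    finally show ?thesis by (simp add: scalar_prod_ge_0_real)
  qed
  \<comment> \<open>The value 0 erases the columns of \<open>F\<close> with eigenvalue zero, and
    \<open>h\<close> is the indicator of the remaining ones.\<close>
  define g where "g i = (if d i = 0 then 0 else 1 / sqrt (d i))" for i
  define h where "h i = (if d i = 0 then 0 else 1 :: real)" for i
  define F where "F = B * U * mat_diag k g"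
  have F: "F \<in> carrier_mat m k" using B U(1) by (simp add: F_def mult_carrier_mat[of _ m k])
  have gt: "transpose_mat (mat_diag k g) = mat_diag k g" by (intro eq_matI) (auto simp: mat_diag_def)
  have "g i * (d i * g i) = h i" if "i < k" for i
    using d[OF that] by (auto simp: g_def h_def)
  then have gdg: "mat_diag k (\<lambda>i. g i * (d i * g i)) = mat_diag k h" 
    by (intro eq_matI) (auto simp: mat_diag_def)
  note alg = assoc_mult_mat[of _ k k _ k _ k] mult_carrier_mat[of _ k k _ k] mult_carrier_mat[of _ k m _ k]
     assoc_mult_mat[of _ k m _ k _ k] assoc_mult_mat[of _ k k _ m _ k] mult_carrier_mat[of _ m k _ k]
     assoc_mult_mat[of _ m k _ k _ k] transpose_mult[of _ m k _ k] transpose_mult[of _ k k _ k]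
     left_mult_one_mat[of _ k k]
  have "transpose_mat F * F = mat_diag k g * (transpose_mat U * ((transpose_mat B * B) * (U * mat_diag k g)))"
    using B U(1) gt by (simp add: F_def alg)
  also have "\<dots> = mat_diag k g * ((transpose_mat U * U) * (mat_diag k d * ((transpose_mat U * U) * mat_diag k g)))"
    unfolding BU using U(1) by (simp add: alg)
  also have "\<dots> = mat_diag k h" unfolding U(2) by (simp add: alg gdg)
  finally have FF: "transpose_mat F * F = mat_diag k h" .
  have gh: "(\<lambda>i. g i * h i) = g" by (auto simp: g_def h_def)
  have Fh: "F * mat_diag k h = F"
    unfolding F_def using B U(1) gh by (simp add: alg)
  have Ft: "transpose_mat F \<in> carrier_mat k m" using F by simp
  have "(F * transpose_mat F) * (F * transpose_mat F) = F * (transpose_mat F * (F * transpose_mat F))"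
    by (rule assoc_mult_mat[OF F Ft mult_carrier_mat[OF F Ft]])
  also have "transpose_mat F * (F * transpose_mat F) = mat_diag k h * transpose_mat F"
    unfolding assoc_mult_mat[OF Ft F Ft, symmetric] FF ..
  also have "F * (mat_diag k h * transpose_mat F) = F * transpose_mat F"
    unfolding assoc_mult_mat[OF F mat_diag_dim Ft, symmetric] Fh ..
  finally have idem: "(F * transpose_mat F) * (F * transpose_mat F) = F * transpose_mat F" .
  have P: "F * transpose_mat F \<in> carrier_mat m m" "transpose_mat (F * transpose_mat F) = F * transpose_mat F"
    using F by (simp_all add: transpose_mult[of _ m k _ m])
  \<comment> \<open>\<open>F\<close> times its transpose is an orthogonal projection of R^m, with
    trace at most \<open>m\<close>; in the other order the product is the indicator matrix, whose
    trace is the count.\<close>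
  have "mtrace (F * transpose_mat F) = (\<Sum>j<m. (F * transpose_mat F) $$ (j,j))" using F by (simp add: mtrace_def)
  also have "\<dots> \<le> (\<Sum>j<m. 1)" using symmetric_idempotent_diag_le_1[OF P idem] by (intro sum_mono) auto
  finally have "mtrace (F * transpose_mat F) \<le> real m" by simp
  moreover have "mtrace (F * transpose_mat F) = mtrace (transpose_mat F * F)"
    by (rule mtrace_comm[of _ m k]) (use F in auto)
  moreover have "mtrace (transpose_mat F * F) = real (card {i. i < k \<and> d i \<noteq> 0})"
  proof -
    have "mtrace (transpose_mat F * F) = (\<Sum>i<k. h i)" unfolding FF by (simp add: mtrace_def mat_diag_def)
    also have "\<dots> = (\<Sum>i\<in>{i. i < k \<and> d i \<noteq> 0}. 1)"
      by (intro sum.mono_neutral_cong_right) (auto simp: h_def)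
    finally show ?thesis by simp
  qed
  ultimately show ?thesis by simp
qed

text \<open>The first \<open>m\<close> entries of the decreasing eigenvalue list are at least its
  m-th. Comparing multisets carries this count, ties included, to the indices of the given
  decomposition.\<close>

lemma card_ge_eig_desc:
  assumes U: "U \<in> carrier_mat k k" "transpose_mat U * U = 1\<^sub>m k" "U * transpose_mat U = 1\<^sub>m k"
    and AU: "A = U * mat_diag k d * transpose_mat U" and m: "0 < m" "m \<le> k"
  shows "m \<le> card {i. i < k \<and> eig_desc A m \<le> d i}"
proof -
  let ?M = "image_mset d (mset_set {..<k})"
  define ys where "ys = rev (sorted_list_of_multiset ?M)"
  have ev: "eigenvalues_mset A = ?M" unfolding AU by (rule eigenvalues_mset_orthogonal_diag[OF U])
  have \<mu>: "eig_desc A m = ys ! (m - 1)" by (simp add: eig_desc_def ev ys_def)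
  have mset: "mset ys = ?M" by (simp add: ys_def)
  have len: "length ys = k" using arg_cong[OF mset, of size] by simp
  have sorted: "sorted (rev ys)" by (simp add: ys_def)
  \<comment> \<open>\<open>eig_desc\<close> counts from 1 and lists from 0, so the m-th largest
    eigenvalue sits at position \<open>m - 1\<close>.\<close>
  have ge: "ys ! (m - 1) \<le> ys ! j" if "j < m" for j
    using sorted_rev_nth_mono[OF sorted, of j "m - 1"] that m len by simp
  have "m = card {..<m}" by simp
  also have "\<dots> \<le> card {j. j < length ys \<and> eig_desc A m \<le> ys ! j}"
    by (rule card_mono) (use ge m len \<mu> in auto)
  also have "\<dots> = length (filter (\<lambda>x. eig_desc A m \<le> x) ys)" by (simp add: length_filter_conv_card)
  also have "\<dots> = size (filter_mset (\<lambda>x. eig_desc A m \<le> x) ?M)" by (simp flip: mset mset_filter)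
  also have "\<dots> = card {i. i < k \<and> eig_desc A m \<le> d i}"
    by (simp add: filter_mset_image_mset filter_mset_mset_set)
  finally show ?thesis .
qed

text \<open>Pigeonhole: at least \<open>m\<close> indices carry eigenvalues no smaller than the
  positive m-th one, and at most \<open>m\<close> carry nonzero ones. A nonzero eigenvalue below it
  would be one too many.\<close>

lemma gram_eigenvalue_zero_or_ge:
  assumes B: "B \<in> carrier_mat m k"
    and U: "U \<in> carrier_mat k k" "transpose_mat U * U = 1\<^sub>m k" "U * transpose_mat U = 1\<^sub>m k"
    and BU: "transpose_mat B * B = U * mat_diag k d * transpose_mat U"
    and m: "0 < m" "m \<le> k" and pos: "0 < eig_desc (transpose_mat B * B) m" and i: "i < k"
  shows "d i = 0 \<or> eig_desc (transpose_mat B * B) m \<le> d i"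
proof (rule ccontr)
  let ?\<mu> = "eig_desc (transpose_mat B * B) m"
  assume "\<not> ?thesis"
  then have sub: "insert i {i. i < k \<and> ?\<mu> \<le> d i} \<subseteq> {i. i < k \<and> d i \<noteq> 0}" and ni: "\<not> ?\<mu> \<le> d i"
    using pos i by auto
  have "card (insert i {i. i < k \<and> ?\<mu> \<le> d i}) \<le> card {i. i < k \<and> d i \<noteq> 0}"
    by (rule card_mono[OF _ sub]) simp
  then have "Suc (card {i. i < k \<and> ?\<mu> \<le> d i}) \<le> card {i. i < k \<and> d i \<noteq> 0}"
    using ni by simp
  then show False
    using card_ge_eig_desc[OF U BU m] card_nonzero_eigenvalues_gram_le[OF B U(1,2) BU] by simp
qed

text \<open>An eigenvalue d that is 0 or at least mu satisfies mu d <= d^2 and mu d^2 <= d^3. The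
  two claims are the forms of mu A <= A^2 and mu A^2 <= A^3, expanded in an eigenbasis.\<close>

lemma gram_quadform_gap:
  assumes B: "B \<in> carrier_mat m k" and m: "0 < m" "m \<le> k"
  defines "A \<equiv> transpose_mat B * B"
  assumes pos: "0 < eig_desc A m" and v: "v \<in> carrier_vec k"
  shows "eig_desc A m * (v \<bullet> (A *\<^sub>v v)) \<le> (A *\<^sub>v v) \<bullet> (A *\<^sub>v v)" 
    and "eig_desc A m * ((A *\<^sub>v v) \<bullet> (A *\<^sub>v v)) \<le> (A *\<^sub>v v) \<bullet> (A *\<^sub>v (A *\<^sub>v v))"
proof -
  have A: "A \<in> carrier_mat k k" "transpose_mat A = A" using B by (simp_all add: A_def transpose_mult[of _ k m _ k])
  obtain U d where U: "U \<in> carrier_mat k k" "transpose_mat U * U = 1\<^sub>m k" "U * transpose_mat U = 1\<^sub>m k"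
    and AU: "A = U * mat_diag k d * transpose_mat U"
    using spectral_theorem_symmetric[OF A] by blast
  have gap: "d i = 0 \<or> eig_desc A m \<le> d i" if "i < k" for i
    using gram_eigenvalue_zero_or_ge[OF B U AU[unfolded A_def] m pos[unfolded A_def] that] A_def by simp
  have Av: "A *\<^sub>v v \<in> carrier_vec k" using A v by auto
  have q: "w \<bullet> (A *\<^sub>v z) = (\<Sum>i<k. d i * (col U i \<bullet> w) * (col U i \<bullet> z))" 
    if "w \<in> carrier_vec k" "z \<in> carrier_vec k" for w z
    unfolding AU by (rule quadform_orthogonal_diag[OF U(1) that(2,1)])
  have co: "col U i \<bullet> (A *\<^sub>v v) = d i * (col U i \<bullet> v)" if i: "i < k" for i
  proof -
    have c: "col U i \<in> carrier_vec k" using U by (metis carrier_matD(1) col_dim)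
    show ?thesis unfolding q[OF c v] using i 
      by (subst sum.remove[of _ i]) (auto simp: orthogonal_cols[OF U(1,2)])
  qed
  let ?c = "\<lambda>i. (col U i \<bullet> v)\<^sup>2"
  have e1: "v \<bullet> (A *\<^sub>v v) = (\<Sum>i<k. d i * ?c i)" unfolding q[OF v v] by (simp add: power2_eq_square mult_ac)
  have "(A *\<^sub>v v) \<bullet> (A *\<^sub>v v) = (\<Sum>i<k. d i * (d i * (col U i \<bullet> v)) * (col U i \<bullet> v))" 
    unfolding q[OF Av v] by (intro sum.cong) (simp_all add: co)
  then have e2: "(A *\<^sub>v v) \<bullet> (A *\<^sub>v v) = (\<Sum>i<k. d i * d i * ?c i)" by (simp add: power2_eq_square mult_ac)
  have "(A *\<^sub>v v) \<bullet> (A *\<^sub>v (A *\<^sub>v v)) = (\<Sum>i<k. d i * (d i * (col U i \<bullet> v)) * (d i * (col U i \<bullet> v)))" 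
    unfolding q[OF Av Av] by (intro sum.cong) (simp_all add: co)
  then have e3: "(A *\<^sub>v v) \<bullet> (A *\<^sub>v (A *\<^sub>v v)) = (\<Sum>i<k. d i * (d i * d i) * ?c i)" by (simp add: power2_eq_square mult_ac)
  have "eig_desc A m * (d i * ?c i) \<le> d i * d i * ?c i" if "i < k" for i
  proof (cases "d i = 0")
    case False
    then have "eig_desc A m \<le> d i" using gap[OF that] by simp
    moreover have "0 \<le> d i * ?c i" using calculation pos by simp
    ultimately have "eig_desc A m * (d i * ?c i) \<le> d i * (d i * ?c i)" by (rule mult_right_mono)
    then show ?thesis by (simp add: mult_ac)
  qed simp
  then show "eig_desc A m * (v \<bullet> (A *\<^sub>v v)) \<le> (A *\<^sub>v v) \<bullet> (A *\<^sub>v v)"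
    unfolding e1 e2 sum_distrib_left by (intro sum_mono) auto
  have "eig_desc A m * (d i * d i * ?c i) \<le> d i * (d i * d i) * ?c i" if "i < k" for i
  proof (cases "d i = 0")
    case False
    then have "eig_desc A m \<le> d i" using gap[OF that] by simp
    moreover have "0 \<le> d i * d i * ?c i" by simp
    ultimately have "eig_desc A m * (d i * d i * ?c i) \<le> d i * (d i * d i * ?c i)" by (rule mult_right_mono)
    then show ?thesis by (simp add: mult_ac)
  qed simp
  then show "eig_desc A m * ((A *\<^sub>v v) \<bullet> (A *\<^sub>v v)) \<le> (A *\<^sub>v v) \<bullet> (A *\<^sub>v (A *\<^sub>v v))"
    unfolding e2 e3 sum_distrib_left by (intro sum_mono) auto
qed

lemma full_row_rank_gram_pos_def:
  assumes L: "L \<in> carrier_mat m k" and rank: "vec_space.rank m L = m"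
  shows "pos_def m (L * transpose_mat L)"
  unfolding pos_def_def
proof (intro ballI impI)
  fix v :: "real vec" assume v: "v \<in> carrier_vec m" "v \<noteq> 0\<^sub>v m"
  have Lv: "transpose_mat L *\<^sub>v v \<in> carrier_vec k" using L v by auto
  have "v \<bullet> ((L * transpose_mat L) *\<^sub>v v) = v \<bullet> (L *\<^sub>v (transpose_mat L *\<^sub>v v))"
    using L v by (simp add: assoc_mult_mat_vec[of _ m k _ m])
  also have "\<dots> = (transpose_mat L *\<^sub>v v) \<bullet> (transpose_mat L *\<^sub>v v)"
    using transpose_vec_mult_scalar[OF L Lv v(1)] by simp
  finally show "v \<bullet> ((L * transpose_mat L) *\<^sub>v v) > 0"
    using full_row_rank_transpose_kernel[OF L rank v(1)] v(2) scalar_prod_ge_0_real[of "transpose_mat L *\<^sub>v v"]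
      scalar_prod_eq_0_real[OF Lv] by fastforce
qed

text \<open>The preimage is L^T (L L^T)^(-1) x; the inverse is available as the square of
  \<open>inv_sqrt_mat\<close>.\<close>

lemma full_row_rank_surj:
  assumes L: "L \<in> carrier_mat m k" and rank: "vec_space.rank m L = m" and x: "x \<in> carrier_vec m"
  shows "\<exists>w\<in>carrier_vec k. L *\<^sub>v w = (x :: real vec)"
proof -
  let ?N = "L * transpose_mat L"
  have N: "?N \<in> carrier_mat m m" "transpose_mat ?N = ?N" using L by (simp_all add: transpose_mult[of _ m k _ m])
  note R = inv_sqrt_mat[OF N full_row_rank_gram_pos_def[OF L rank]]
  let ?Q = "inv_sqrt_mat m ?N * inv_sqrt_mat m ?N"
  have Q: "?Q \<in> carrier_mat m m" using R(1) by simp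
  have "?N * ?Q = 1\<^sub>m m" by (rule mat_mult_left_right_inverse[OF Q N(1) R(4)])
  then have "?N *\<^sub>v (?Q *\<^sub>v x) = x"
    using assoc_mult_mat_vec[OF N(1) Q x] x by simp
  moreover have "?Q *\<^sub>v x \<in> carrier_vec m" using Q x by auto
  ultimately have "L *\<^sub>v (transpose_mat L *\<^sub>v (?Q *\<^sub>v x)) = x"
    using assoc_mult_mat_vec[of L m k "transpose_mat L" m "?Q *\<^sub>v x"] L by simp
  moreover have "transpose_mat L *\<^sub>v (?Q *\<^sub>v x) \<in> carrier_vec k" 
    using L \<open>?Q *\<^sub>v x \<in> carrier_vec m\<close> by auto
  ultimately show ?thesis by blast
qed

section \<open>Loewner bounds for L L^T and S from the spectral gap of L^T S L\<close>

context
  fixes S L :: "real mat" and m k :: nat and \<mu> :: real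
  assumes S: "S \<in> carrier_mat m m" "transpose_mat S = S" "pos_def m S"
    and L: "L \<in> carrier_mat m k" and rank: "vec_space.rank m L = m" and m: "0 < m"
    and \<mu>: "\<mu> = eig_desc (transpose_mat L * S * L) m" "0 < \<mu>"
begin

text \<open>With \<open>W\<close> the square root of \<open>S\<close>, \<open>A\<close> is the Gram
  matrix of the m x k matrix \<open>W * L\<close>, and full rank supplies
  \<open>m \<le> k\<close>.\<close>

lemma gram_gap:
  defines "A \<equiv> transpose_mat L * S * L"
  assumes v: "v \<in> carrier_vec k"
  shows "\<mu> * (v \<bullet> (A *\<^sub>v v)) \<le> (A *\<^sub>v v) \<bullet> (A *\<^sub>v v)" 
    and "\<mu> * ((A *\<^sub>v v) \<bullet> (A *\<^sub>v v)) \<le> (A *\<^sub>v v) \<bullet> (A *\<^sub>v (A *\<^sub>v v))"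
proof -
  obtain W where W: "W \<in> carrier_mat m m" "transpose_mat W = W" "W * W = S"
    using inv_sqrt_mat_inverse[OF S] by blast
  have WL: "W * L \<in> carrier_mat m k" using W(1) L by simp
  have "transpose_mat (W * L) * (W * L) = transpose_mat L * W * (W * L)"
    using W(1,2) L by (simp add: transpose_mult[of _ m m _ k])
  also have "\<dots> = transpose_mat L * (W * (W * L))" using W(1) L by (intro assoc_mult_mat[of _ k m _ m _ k]) auto
  also have "W * (W * L) = S * L" using assoc_mult_mat[OF W(1) W(1) L] W(3) by simp
  also have "transpose_mat L * (S * L) = A" unfolding A_def using S(1) L by (intro assoc_mult_mat[symmetric, of _ k m _ m _ k]) auto
  finally have AW: "transpose_mat (W * L) * (W * L) = A" .
  have mk: "m \<le> k" using vec_space.rank_le_nc[OF L] rank by simp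
  have \<mu>A: "\<mu> = eig_desc A m" using \<mu> A_def by simp
  show "\<mu> * (v \<bullet> (A *\<^sub>v v)) \<le> (A *\<^sub>v v) \<bullet> (A *\<^sub>v v)" 
    "\<mu> * ((A *\<^sub>v v) \<bullet> (A *\<^sub>v v)) \<le> (A *\<^sub>v v) \<bullet> (A *\<^sub>v (A *\<^sub>v v))"
    using gram_quadform_gap[OF WL m mk _ v, unfolded AW, folded \<mu>A] \<mu>(2) by auto
qed

lemma gram_apply:
  assumes y: "y \<in> carrier_vec k"
  shows "(transpose_mat L * S * L) *\<^sub>v y = transpose_mat L *\<^sub>v (S *\<^sub>v (L *\<^sub>v y))"
    and "w \<in> carrier_vec k \<Longrightarrow> w \<bullet> ((transpose_mat L * S * L) *\<^sub>v y) = (L *\<^sub>v w) \<bullet> (S *\<^sub>v (L *\<^sub>v y))"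
proof -
  have SLy: "S *\<^sub>v (L *\<^sub>v y) \<in> carrier_vec m" using S(1) L y by auto
  have LS: "transpose_mat L * S \<in> carrier_mat k m" using L S(1) by simp
  show *: "(transpose_mat L * S * L) *\<^sub>v y = transpose_mat L *\<^sub>v (S *\<^sub>v (L *\<^sub>v y))"
    using assoc_mult_mat_vec[OF LS L y] assoc_mult_mat_vec[of "transpose_mat L" k m S m "L *\<^sub>v y"] L S(1) y by simp
  show "w \<bullet> ((transpose_mat L * S * L) *\<^sub>v y) = (L *\<^sub>v w) \<bullet> (S *\<^sub>v (L *\<^sub>v y))" if "w \<in> carrier_vec k"
    unfolding * using transpose_vec_mult_scalar[of "transpose_mat L" k m "S *\<^sub>v (L *\<^sub>v y)" w] L SLy that by simp
qed

text \<open>Choose w with L w = S^(-1) v. Then w.Aw = v.S^(-1)v and A w = L^T v, so mu A <= A^2 at w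
  becomes L L^T >= mu S^(-1); the inverse is written through its square root.\<close>

lemma gram_ge_inverse:
  assumes v: "v \<in> carrier_vec m"
  shows "\<mu> * ((inv_sqrt_mat m S *\<^sub>v v) \<bullet> (inv_sqrt_mat m S *\<^sub>v v)) \<le> v \<bullet> ((L * transpose_mat L) *\<^sub>v v)"
proof -
  let ?R = "inv_sqrt_mat m S"
  note R = inv_sqrt_mat[OF S]
  have Rv: "?R *\<^sub>v v \<in> carrier_vec m" and RRv: "?R *\<^sub>v (?R *\<^sub>v v) \<in> carrier_vec m" using R(1) v by auto
  obtain w where w: "w \<in> carrier_vec k" "L *\<^sub>v w = ?R *\<^sub>v (?R *\<^sub>v v)"
    using full_row_rank_surj[OF L rank RRv] by blast
  have RR: "?R * ?R \<in> carrier_mat m m" using R(1) by simp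
  have "S *\<^sub>v (?R *\<^sub>v (?R *\<^sub>v v)) = (S * (?R * ?R)) *\<^sub>v v"
    using assoc_mult_mat_vec[OF S(1) RR v] assoc_mult_mat_vec[OF R(1) R(1) v] by simp
  then have SL: "S *\<^sub>v (L *\<^sub>v w) = v"
    unfolding w(2) mat_mult_left_right_inverse[OF RR S(1) R(4)] using v by simp
  have "(?R *\<^sub>v v) \<bullet> (?R *\<^sub>v v) = (?R *\<^sub>v (?R *\<^sub>v v)) \<bullet> v"
    using scalar_prod_symmetric_mat[OF R(1,2) Rv v] by simp
  also have "\<dots> = w \<bullet> ((transpose_mat L * S * L) *\<^sub>v w)"
    using SL w(2) by (simp add: gram_apply(2)[OF w(1,1)])
  finally have "\<mu> * ((?R *\<^sub>v v) \<bullet> (?R *\<^sub>v v)) \<le> (transpose_mat L *\<^sub>v v) \<bullet> (transpose_mat L *\<^sub>v v)"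
    using gram_gap(1)[OF w(1)] unfolding gram_apply(1)[OF w(1)] SL by simp
  also have "\<dots> = v \<bullet> ((L * transpose_mat L) *\<^sub>v v)"
    using transpose_vec_mult_scalar[OF L _ v, of "transpose_mat L *\<^sub>v v"] assoc_mult_mat_vec[of L m k "transpose_mat L" m v] L v by simp
  finally show ?thesis .
qed

text \<open>Let N = c L L^T, q = N^(-1) v and z = c L^T q. Then L z = v and |z|^2 = c v.N^(-1)v,
  while z = A y for any y with L y = S^(-1)(c q). So mu A^2 <= A^3 at y reads mu |z|^2 <= z.Az =
  v.Sv.\<close>

lemma ge_gram_inverse:
  assumes c: "0 < c" and v: "v \<in> carrier_vec m"
  defines "R \<equiv> inv_sqrt_mat m (c \<cdot>\<^sub>m (L * transpose_mat L))"
  shows "\<mu> * c * ((R *\<^sub>v v) \<bullet> (R *\<^sub>v v)) \<le> v \<bullet> (S *\<^sub>v v)"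
proof -
  let ?N = "c \<cdot>\<^sub>m (L * transpose_mat L)"
  have LL: "L * transpose_mat L \<in> carrier_mat m m" using L by simp
  have "transpose_mat ?N = c \<cdot>\<^sub>m transpose_mat (L * transpose_mat L)" by (intro eq_matI) auto
  then have N: "?N \<in> carrier_mat m m" "transpose_mat ?N = ?N" 
    using L by (simp_all add: transpose_mult[of _ m k _ m])
  have "pos_def m ?N" by (rule pos_def_smult[OF LL full_row_rank_gram_pos_def[OF L rank] c])
  note R = inv_sqrt_mat[OF N this, folded R_def]
  have RR: "R * R \<in> carrier_mat m m" using R(1) by simp
  define q where "q = (R * R) *\<^sub>v v"
  have q: "q \<in> carrier_vec m" using RR v by (simp add: q_def)
  have Nq: "?N *\<^sub>v q = v"
    unfolding q_def using assoc_mult_mat_vec[OF N(1) RR v] mat_mult_left_right_inverse[OF RR N(1) R(4)] v by simp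
  have Lq: "transpose_mat L *\<^sub>v q \<in> carrier_vec k" using L q by auto
  define z where "z = c \<cdot>\<^sub>v (transpose_mat L *\<^sub>v q)"
  have z: "z \<in> carrier_vec k" using Lq by (simp add: z_def)
  have Lz: "L *\<^sub>v z = v"
    unfolding z_def using mult_mat_vec[OF L Lq, of c] assoc_mult_mat_vec[of L m k "transpose_mat L" m q] L q Nq LL
    by (simp add: smult_mat_mult_vec)
  note RS = inv_sqrt_mat[OF S]
  let ?Q = "inv_sqrt_mat m S * inv_sqrt_mat m S"
  have Q: "?Q \<in> carrier_mat m m" using RS(1) by simp
  have cq: "c \<cdot>\<^sub>v q \<in> carrier_vec m" using q by simp
  have "?Q *\<^sub>v (c \<cdot>\<^sub>v q) \<in> carrier_vec m" using Q cq by (rule mult_mat_vec_carrier)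
  then obtain y where y: "y \<in> carrier_vec k" "L *\<^sub>v y = ?Q *\<^sub>v (c \<cdot>\<^sub>v q)"
    using full_row_rank_surj[OF L rank] by blast
  have "S *\<^sub>v (L *\<^sub>v y) = c \<cdot>\<^sub>v q"
    unfolding y(2) using assoc_mult_mat_vec[OF S(1) Q cq] mat_mult_left_right_inverse[OF Q S(1) RS(4)] cq by simp
  then have Ay: "(transpose_mat L * S * L) *\<^sub>v y = z"
    unfolding gram_apply(1)[OF y(1)] z_def using mult_mat_vec[of "transpose_mat L" k m q c] L q by simp
  have "z \<bullet> z = c * ((transpose_mat L *\<^sub>v q) \<bullet> z)" using Lq z by (simp add: z_def)
  also have "(transpose_mat L *\<^sub>v q) \<bullet> z = q \<bullet> v"
    using transpose_vec_mult_scalar[OF L z q] Lz by simp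
  also have "q \<bullet> v = (R *\<^sub>v (R *\<^sub>v v)) \<bullet> v" unfolding q_def using R(1) v by (simp add: assoc_mult_mat_vec[of _ m m _ m])
  also have "\<dots> = (R *\<^sub>v v) \<bullet> (R *\<^sub>v v)"
    using R(1) v by (intro scalar_prod_symmetric_mat[OF R(1,2)]) auto
  finally have "\<mu> * c * ((R *\<^sub>v v) \<bullet> (R *\<^sub>v v)) = \<mu> * (z \<bullet> z)" by simp
  also have "\<dots> \<le> z \<bullet> ((transpose_mat L * S * L) *\<^sub>v z)" using gram_gap(2)[OF y(1)] unfolding Ay .
  also have "\<dots> = v \<bullet> (S *\<^sub>v v)" unfolding gram_apply(2)[OF z z] Lz ..
  finally show ?thesis .
qed

end

section \<open>Covariances of square integrable vectors\<close>

definition sq_integrable :: "'a measure \<Rightarrow> ('a \<Rightarrow> real) \<Rightarrow> bool" where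
  "sq_integrable M F \<longleftrightarrow> F \<in> borel_measurable M \<and> integrable M (\<lambda>x. (F x)\<^sup>2)"

definition covar :: "'a measure \<Rightarrow> ('a \<Rightarrow> real) \<Rightarrow> ('a \<Rightarrow> real) \<Rightarrow> real" where
  "covar M F G = (\<integral>x. F x * G x \<partial>M) - (\<integral>x. F x \<partial>M) * (\<integral>x. G x \<partial>M)"

lemma sq_integrable_mult:
  assumes "sq_integrable M F" "sq_integrable M G"
  shows "integrable M (\<lambda>x. F x * G x)"
proof (rule Bochner_Integration.integrable_bound)
  show "integrable M (\<lambda>x. (F x)\<^sup>2 + (G x)\<^sup>2)" using assms by (simp add: sq_integrable_def)
  show "(\<lambda>x. F x * G x) \<in> borel_measurable M" using assms by (auto simp: sq_integrable_def)
  have "\<bar>a * b\<bar> \<le> a\<^sup>2 + b\<^sup>2" for a b :: real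
    using sum_squares_bound[of "\<bar>a\<bar>" "\<bar>b\<bar>"] abs_ge_zero[of "a * b"] unfolding abs_mult power2_abs by linarith
  then show "AE x in M. norm (F x * G x) \<le> norm ((F x)\<^sup>2 + (G x)\<^sup>2)" by auto
qed

lemma sq_integrable_lincomb:
  assumes "\<And>i. i \<in> I \<Longrightarrow> sq_integrable M (F i)"
  shows "sq_integrable M (\<lambda>x. \<Sum>i\<in>I. a i * F i x)"
proof -
  have "integrable M (\<lambda>x. \<Sum>i\<in>I. \<Sum>j\<in>I. (a i * a j) * (F i x * F j x))"
    using assms by (intro Bochner_Integration.integrable_sum integrable_mult_right sq_integrable_mult) auto
  then have "integrable M (\<lambda>x. (\<Sum>i\<in>I. a i * F i x)\<^sup>2)"
    by (simp add: power2_eq_square sum_product mult_ac)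
  then show ?thesis using assms 
    by (auto simp: sq_integrable_def intro!: borel_measurable_sum borel_measurable_times)
qed

lemma sq_integrable_add:
  assumes "sq_integrable M F" "sq_integrable M G"
  shows "sq_integrable M (\<lambda>x. F x + c * G x)"
  \<comment> \<open>The pair is treated as a family indexed by \<open>bool\<close> with coefficients
    1 and \<open>c\<close>.\<close>
  using sq_integrable_lincomb[of "UNIV :: bool set" M "\<lambda>b. if b then F else G" "\<lambda>b. if b then 1 else c"] assms
  by (simp add: UNIV_bool add.commute)

context prob_space
begin

lemma sq_integrable_imp_integrable: "sq_integrable M F \<Longrightarrow> integrable M F"
  unfolding sq_integrable_def by (auto intro: square_integrable_imp_integrable)

lemma covar_nonneg:
  assumes "sq_integrable M F" shows "0 \<le> covar M F F"
proof -
  have "variance F = covar M F F"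
    using assms sq_integrable_imp_integrable[OF assms]
    by (subst variance_eq) (auto simp: sq_integrable_def covar_def power2_eq_square)
  then show ?thesis using variance_positive[of F] by simp
qed

lemma covar_le_second_moment: "covar M F F \<le> (\<integral>x. (F x)\<^sup>2 \<partial>M)"
  by (simp add: covar_def power2_eq_square)

lemma covar_lincomb:
  assumes F: "\<And>i. i \<in> I \<Longrightarrow> sq_integrable M (F i)" and G: "\<And>j. j \<in> J \<Longrightarrow> sq_integrable M (G j)"
  shows "covar M (\<lambda>x. \<Sum>i\<in>I. a i * F i x) (\<lambda>x. \<Sum>j\<in>J. b j * G j x)
    = (\<Sum>i\<in>I. \<Sum>j\<in>J. a i * b j * covar M (F i) (G j))"
proof -
  have "(\<integral>x. (\<Sum>i\<in>I. a i * F i x) * (\<Sum>j\<in>J. b j * G j x) \<partial>M) 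
      = (\<integral>x. (\<Sum>i\<in>I. \<Sum>j\<in>J. (a i * b j) * (F i x * G j x)) \<partial>M)"
    by (simp add: sum_product mult_ac)
  also have "\<dots> = (\<Sum>i\<in>I. \<Sum>j\<in>J. (a i * b j) * (\<integral>x. F i x * G j x \<partial>M))"
  proof (subst Bochner_Integration.integral_sum)
    show "integrable M (\<lambda>x. \<Sum>j\<in>J. (a i * b j) * (F i x * G j x))" if "i \<in> I" for i
      using that F G by (intro Bochner_Integration.integrable_sum integrable_mult_right sq_integrable_mult) auto
    show "(\<Sum>i\<in>I. \<integral>x. (\<Sum>j\<in>J. (a i * b j) * (F i x * G j x)) \<partial>M) 
      = (\<Sum>i\<in>I. \<Sum>j\<in>J. (a i * b j) * (\<integral>x. F i x * G j x \<partial>M))"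
    proof (rule sum.cong[OF refl])
      fix i assume "i \<in> I"
      then have "integrable M (\<lambda>x. (a i * b j) * (F i x * G j x))" if "j \<in> J" for j
        using that F G by (intro integrable_mult_right sq_integrable_mult) auto
      then show "(\<integral>x. (\<Sum>j\<in>J. (a i * b j) * (F i x * G j x)) \<partial>M) 
        = (\<Sum>j\<in>J. (a i * b j) * (\<integral>x. F i x * G j x \<partial>M))"
        by (subst Bochner_Integration.integral_sum) auto
    qed
  qed
  finally have prod: "(\<integral>x. (\<Sum>i\<in>I. a i * F i x) * (\<Sum>j\<in>J. b j * G j x) \<partial>M) 
      = (\<Sum>i\<in>I. \<Sum>j\<in>J. (a i * b j) * (\<integral>x. F i x * G j x \<partial>M))" .
  have "(\<integral>x. (\<Sum>i\<in>I. a i * F i x) \<partial>M) = (\<Sum>i\<in>I. a i * (\<integral>x. F i x \<partial>M))"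
    using F by (subst Bochner_Integration.integral_sum) (auto intro: sq_integrable_imp_integrable)
  moreover have "(\<integral>x. (\<Sum>j\<in>J. b j * G j x) \<partial>M) = (\<Sum>j\<in>J. b j * (\<integral>x. G j x \<partial>M))"
    using G by (subst Bochner_Integration.integral_sum) (auto intro: sq_integrable_imp_integrable)
  ultimately show ?thesis
    unfolding covar_def prod by (simp add: sum_product sum_subtractf right_diff_distrib mult_ac)
qed

lemma covar_add:
  assumes "sq_integrable M F" "sq_integrable M G"
  shows "covar M (\<lambda>x. F x + c * G x) (\<lambda>x. F x + c * G x) = covar M F F + 2 * c * covar M F G + c * c * covar M G G"
proof -
  note i = assms[THEN sq_integrable_imp_integrable] sq_integrable_mult[OF assms(1,1)] sq_integrable_mult[OF assms] sq_integrable_mult[OF assms(2,2)]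
  have "(\<integral>x. (F x + c * G x) * (F x + c * G x) \<partial>M) = (\<integral>x. F x * F x + (2 * c) * (F x * G x) + (c * c) * (G x * G x) \<partial>M)"
    by (rule Bochner_Integration.integral_cong) (auto simp: algebra_simps)
  also have "\<dots> = (\<integral>x. F x * F x \<partial>M) + (2 * c) * (\<integral>x. F x * G x \<partial>M) + (c * c) * (\<integral>x. G x * G x \<partial>M)"
    using i by simp
  finally show ?thesis using i by (simp add: covar_def) (simp add: algebra_simps)
qed

end

lemma covar_commute: "covar M F G = covar M G F"
  by (simp add: covar_def mult.commute)

lemma cross_cov_index:
  "i < d1 \<Longrightarrow> j < d2 \<Longrightarrow> cross_cov M X Y d1 d2 $$ (i,j) = covar M (\<lambda>x. X x $ i) (\<lambda>x. Y x $ j)"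
  by (simp add: cross_cov_def covar_def)

lemma cross_cov_carrier [simp]: "cross_cov M X Y d1 d2 \<in> carrier_mat d1 d2"
  by (simp add: cross_cov_def)

lemma transpose_cov: "transpose_mat (cov M X n) = cov M X n"
proof (rule eq_matI)
  fix i j assume "i < dim_row (cov M X n)" "j < dim_col (cov M X n)"
  then have "i < n" "j < n" by (simp_all add: cov_def cross_cov_def)
  then show "transpose_mat (cov M X n) $$ (i,j) = cov M X n $$ (i,j)"
    by (simp add: cov_def cross_cov_index covar_commute[of M "\<lambda>x. X x $ i"] carrier_matD[OF cross_cov_carrier])
qed (simp_all add: cov_def cross_cov_def)

text \<open>Bilinearity of covariance; it is the bridge by which matrix inequalities follow from
  statements about the scalar variables a.X and b.Y.\<close>

lemma scalar_prod_cross_cov: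
  assumes M: "prob_space M"
    and X: "\<forall>j<n. sq_integrable M (\<lambda>x. X x $ j)" and Y: "\<forall>j<n. sq_integrable M (\<lambda>x. Y x $ j)"
    and a: "a \<in> carrier_vec n" and b: "b \<in> carrier_vec n"
  shows "a \<bullet> (cross_cov M X Y n n *\<^sub>v b) = covar M (\<lambda>x. \<Sum>j<n. a $ j * X x $ j) (\<lambda>x. \<Sum>j<n. b $ j * Y x $ j)"
proof -
  interpret prob_space M by (rule M)
  have "a \<bullet> (cross_cov M X Y n n *\<^sub>v b) = (\<Sum>i<n. a $ i * (\<Sum>j<n. cross_cov M X Y n n $$ (i,j) * b $ j))"
    using a b by (simp add: scalar_prod_def atLeast0LessThan cross_cov_def)
  also have "\<dots> = (\<Sum>i<n. \<Sum>j<n. a $ i * b $ j * covar M (\<lambda>x. X x $ i) (\<lambda>x. Y x $ j))"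
    by (simp add: sum_distrib_left cross_cov_index mult_ac)
  also have "\<dots> = covar M (\<lambda>x. \<Sum>j<n. a $ j * X x $ j) (\<lambda>x. \<Sum>j<n. b $ j * Y x $ j)"
    using X Y by (subst covar_lincomb) auto
  finally show ?thesis .
qed

text \<open>The joint form at (a, b) is the variance of a.X + b.Y.\<close>

lemma joint_psd_cross_cov:
  assumes M: "prob_space M"
    and X: "\<forall>j<n. sq_integrable M (\<lambda>x. X x $ j)" and Y: "\<forall>j<n. sq_integrable M (\<lambda>x. Y x $ j)"
  shows "joint_psd n (cov M X n) (cross_cov M X Y n n) (cov M Y n)"
  unfolding joint_psd_def
proof (intro ballI)
  interpret prob_space M by (rule M)
  fix a b :: "real vec" assume a: "a \<in> carrier_vec n" and b: "b \<in> carrier_vec n"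
  let ?F = "\<lambda>x. \<Sum>j<n. a $ j * X x $ j" and ?G = "\<lambda>x. \<Sum>j<n. b $ j * Y x $ j"
  have F: "sq_integrable M ?F" and G: "sq_integrable M ?G" using X Y by (auto intro: sq_integrable_lincomb)
  have "0 \<le> covar M ?F ?F + 2 * covar M ?F ?G + covar M ?G ?G"
    using covar_nonneg[OF sq_integrable_add[OF F G, of 1]] unfolding covar_add[OF F G] by simp
  then show "0 \<le> a \<bullet> (cov M X n *\<^sub>v a) + 2 * (a \<bullet> (cross_cov M X Y n n *\<^sub>v b)) + b \<bullet> (cov M Y n *\<^sub>v b)"
    unfolding cov_def scalar_prod_cross_cov[OF M X Y a b] scalar_prod_cross_cov[OF M X X a a] scalar_prod_cross_cov[OF M Y Y b b] .
qed

text \<open>A covariance form is nonnegative, so where it vanishes every term of its eigenbasis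
  expansion vanishes, and the vector lies in the kernel. Invertibility leaves only the zero
  vector.\<close>

lemma invertible_cov_pos_def:
  assumes M: "prob_space M" and X: "\<forall>j<n. sq_integrable M (\<lambda>x. X x $ j)"
    and inv: "invertible_mat (cov M X n)"
  shows "pos_def n (cov M X n)"
  unfolding pos_def_def
proof (intro ballI impI)
  fix v :: "real vec" assume v: "v \<in> carrier_vec n" "v \<noteq> 0\<^sub>v n"
  interpret prob_space M by (rule M)
  let ?A = "cov M X n"
  have A: "?A \<in> carrier_mat n n" by (simp add: cov_def)
  obtain B where AB: "?A * B = 1\<^sub>m n" and BA: "B * ?A = 1\<^sub>m (dim_row B)" 
    using inv A unfolding invertible_mat_def inverts_mat_def by auto
  have B: "B \<in> carrier_mat n n" using arg_cong[OF AB, of dim_col] arg_cong[OF BA, of dim_col] A by auto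
  have nonneg: "0 \<le> w \<bullet> (?A *\<^sub>v w)" if "w \<in> carrier_vec n" for w
    unfolding cov_def scalar_prod_cross_cov[OF M X X that that]
    using X by (intro covar_nonneg sq_integrable_lincomb) auto
  obtain U d where U: "U \<in> carrier_mat n n" "transpose_mat U * U = 1\<^sub>m n" "U * transpose_mat U = 1\<^sub>m n"
    and AU: "?A = U * mat_diag n d * transpose_mat U"
    using spectral_theorem_symmetric[OF A transpose_cov] by blast
  have c: "i < n \<Longrightarrow> col U i \<in> carrier_vec n" for i using U by (metis carrier_matD(1) col_dim)
  have d: "0 \<le> d i" if i: "i < n" for i
    using nonneg[OF c[OF i]] orthogonal_diag_eigenvalue[OF U(1,2) i, of d] AU by simp
  have q: "w \<bullet> (?A *\<^sub>v v) = (\<Sum>i<n. d i * (col U i \<bullet> w) * (col U i \<bullet> v))" if "w \<in> carrier_vec n" for w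
    unfolding AU by (rule quadform_orthogonal_diag[OF U(1) v(1) that])
  show "0 < v \<bullet> (?A *\<^sub>v v)"
  proof (rule ccontr)
    assume "\<not> ?thesis"
    then have "(\<Sum>i<n. d i * (col U i \<bullet> v) * (col U i \<bullet> v)) = 0" using nonneg[OF v(1)] q[OF v(1)] by simp
    then have "\<forall>i\<in>{..<n}. d i * (col U i \<bullet> v) * (col U i \<bullet> v) = 0"
      by (subst (asm) sum_nonneg_eq_0_iff) (auto simp: d mult.assoc)
    then have z: "d i * (col U i \<bullet> v) = 0" if "i < n" for i using that by auto
    have Av: "?A *\<^sub>v v \<in> carrier_vec n" using A v by auto
    have "(?A *\<^sub>v v) \<bullet> (?A *\<^sub>v v) = (\<Sum>i<n. (col U i \<bullet> (?A *\<^sub>v v)) * (d i * (col U i \<bullet> v)))"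
      unfolding q[OF Av] by (simp add: mult_ac)
    also have "\<dots> = 0" by (intro sum.neutral) (simp add: z)
    finally have "?A *\<^sub>v v = 0\<^sub>v n" using scalar_prod_eq_0_real[OF Av] by simp
    then have "B *\<^sub>v (?A *\<^sub>v v) = 0\<^sub>v n" using B by (intro eq_vecI) (auto simp: scalar_prod_def)
    then have "(B * ?A) *\<^sub>v v = 0\<^sub>v n" using assoc_mult_mat_vec[OF B A v(1)] by simp
    then show False using BA B v by simp
  qed
qed

section \<open>Logits and centred unembeddings\<close>

lemma unemb_carrier [simp]: "unemb g m k \<in> carrier_mat m k"
  by (simp add: unemb_def)

lemma col_unemb: "i < k \<Longrightarrow> dim_vec (g i) = m \<Longrightarrow> col (unemb g m k) i = g i"
  by (intro eq_vecI) (auto simp: unemb_def)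

lemma scalar_prod_as_lincomb:
  "dim_vec w = m \<Longrightarrow> v \<bullet> w = (\<Sum>j<m. w $ j * (v $ j :: real))"
  by (simp add: scalar_prod_def atLeast0LessThan mult.commute)

text \<open>The logit vector is L^T f(x). This identifies the matrix behind mu_m with the Gram-type
  matrix whose spectrum has the gap.\<close>

lemma cov_logits:
  assumes M: "prob_space M" and f: "\<forall>j<m. sq_integrable M (\<lambda>x. f x $ j)" and g: "\<forall>i<k. dim_vec (g i) = m"
  shows "cov M (logits f g k) k = transpose_mat (unemb g m k) * cov M f m * unemb g m k"
proof (rule eq_matI)
  let ?L = "unemb g m k"
  have S: "cov M f m \<in> carrier_mat m m" by (simp add: cov_def)
  fix i j assume "i < dim_row (transpose_mat ?L * cov M f m * ?L)" "j < dim_col (transpose_mat ?L * cov M f m * ?L)"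
  then have ij: "i < k" "j < k" by (simp_all add: unemb_def)
  have gc: "g i \<in> carrier_vec m" "g j \<in> carrier_vec m" using g ij by (metis carrier_vecI lessThan_iff)+
  have "cov M (logits f g k) k $$ (i,j) = covar M (\<lambda>x. f x \<bullet> g i) (\<lambda>x. f x \<bullet> g j)"
    using ij by (simp add: cov_def cross_cov_index logits_def)
  also have "\<dots> = covar M (\<lambda>x. \<Sum>l<m. g i $ l * f x $ l) (\<lambda>x. \<Sum>l<m. g j $ l * f x $ l)"
    using g ij by (simp add: scalar_prod_as_lincomb[of _ m])
  also have "\<dots> = g i \<bullet> (cov M f m *\<^sub>v g j)"
    unfolding cov_def scalar_prod_cross_cov[OF M f f gc] ..
  finally show "cov M (logits f g k) k $$ (i,j) = (transpose_mat ?L * cov M f m * ?L) $$ (i,j)"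
    using sandwich_index[OF unemb_carrier S unemb_carrier ij] g ij by (simp add: col_unemb)
qed (simp_all add: cov_def cross_cov_def unemb_def)

lemma d_logit_sq_ge_mtrace:
  assumes M: "prob_space M" and f: "\<forall>j<m. sq_integrable M (\<lambda>x. f x $ j)" and f': "\<forall>j<m. sq_integrable M (\<lambda>x. f' x $ j)"
    and g: "\<forall>i<k. dim_vec (g i) = m" and g': "\<forall>i<k. dim_vec (g' i) = m"
  defines "L \<equiv> unemb g m k" and "L' \<equiv> unemb g' m k"
  shows "mtrace (transpose_mat L * cov M f m * L) - 2 * mtrace (transpose_mat L * cross_cov M f f' m m * L')
    + mtrace (transpose_mat L' * cov M f' m * L') \<le> d_logit_sq M f g f' g' k"
proof -
  interpret prob_space M by (rule M)
  let ?F = "\<lambda>i x. \<Sum>l<m. g i $ l * f x $ l" and ?G = "\<lambda>i x. \<Sum>l<m. g' i $ l * f' x $ l"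
  have F: "sq_integrable M (?F i)" and G: "sq_integrable M (?G i)" for i 
    using f f' by (auto intro: sq_integrable_lincomb)
  have FG: "sq_integrable M (\<lambda>x. ?F i x + (-1) * ?G i x)" for i by (rule sq_integrable_add[OF F G])
  have S: "cov M f m \<in> carrier_mat m m" "cov M f' m \<in> carrier_mat m m" by (simp_all add: cov_def)
  have "d_logit_sq M f g f' g' k = (\<integral>x. (\<Sum>i<k. (?F i x + (-1) * ?G i x)\<^sup>2) \<partial>M)"
    unfolding d_logit_sq_def using g g'
    by (intro Bochner_Integration.integral_cong) (auto simp: scalar_prod_as_lincomb[of _ m])
  also have "\<dots> = (\<Sum>i<k. \<integral>x. (?F i x + (-1) * ?G i x)\<^sup>2 \<partial>M)"
    using FG unfolding sq_integrable_def by (intro Bochner_Integration.integral_sum) auto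
  \<comment> \<open>The only loss here is the squared mean of the logit difference of each
    label.\<close>
  also have "\<dots> \<ge> (\<Sum>i<k. covar M (\<lambda>x. ?F i x + (-1) * ?G i x) (\<lambda>x. ?F i x + (-1) * ?G i x))"
    by (intro sum_mono covar_le_second_moment)
  finally have le: "(\<Sum>i<k. covar M (\<lambda>x. ?F i x + (-1) * ?G i x) (\<lambda>x. ?F i x + (-1) * ?G i x)) \<le> d_logit_sq M f g f' g' k" .
  have "(\<Sum>i<k. covar M (\<lambda>x. ?F i x + (-1) * ?G i x) (\<lambda>x. ?F i x + (-1) * ?G i x)) 
    = (\<Sum>i<k. g i \<bullet> (cov M f m *\<^sub>v g i) - 2 * (g i \<bullet> (cross_cov M f f' m m *\<^sub>v g' i)) + g' i \<bullet> (cov M f' m *\<^sub>v g' i))"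
  proof (rule sum.cong[OF refl])
    fix i assume "i \<in> {..<k}"
    then have gc: "g i \<in> carrier_vec m" "g' i \<in> carrier_vec m" using g g' by (metis carrier_vecI lessThan_iff)+
    show "covar M (\<lambda>x. ?F i x + (-1) * ?G i x) (\<lambda>x. ?F i x + (-1) * ?G i x) = 
      g i \<bullet> (cov M f m *\<^sub>v g i) - 2 * (g i \<bullet> (cross_cov M f f' m m *\<^sub>v g' i)) + g' i \<bullet> (cov M f' m *\<^sub>v g' i)"
      unfolding covar_add[OF F G] cov_def scalar_prod_cross_cov[OF M f f gc(1,1)] scalar_prod_cross_cov[OF M f f' gc]
        scalar_prod_cross_cov[OF M f' f' gc(2,2)] by simp
  qed
  also have "\<dots> = mtrace (transpose_mat L * cov M f m * L) - 2 * mtrace (transpose_mat L * cross_cov M f f' m m * L')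
    + mtrace (transpose_mat L' * cov M f' m * L')"
    unfolding L_def L'_def mtrace_sandwich[OF unemb_carrier S(1) unemb_carrier] mtrace_sandwich[OF unemb_carrier S(2) unemb_carrier]
      mtrace_sandwich[OF unemb_carrier cross_cov_carrier unemb_carrier]
    using g g' by (simp add: col_unemb sum.distrib sum_subtractf sum_distrib_left)
  finally show ?thesis using le by simp
qed

text \<open>Centring annihilates the product of means, so only the averaged outer products
  remain.\<close>

lemma cross_cov_uniform_centered:
  assumes k: "0 < k" and "\<forall>j<m. (\<Sum>i<k. g i $ j) = 0"
  shows "cross_cov (measure_pmf (pmf_of_set {..<k})) g g' m m = (1 / real k) \<cdot>\<^sub>m (unemb g m k * transpose_mat (unemb g' m k))"
proof (rule eq_matI)
  let ?N = "(1 / real k) \<cdot>\<^sub>m (unemb g m k * transpose_mat (unemb g' m k))"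
  fix i j assume "i < dim_row ?N" "j < dim_col ?N"
  then have ij: "i < m" "j < m" by (simp_all add: unemb_def)
  have int: "(\<integral>y. h y \<partial>measure_pmf (pmf_of_set {..<k})) = (\<Sum>y<k. h y) / real k" for h :: "nat \<Rightarrow> real"
    using k by (subst integral_pmf_of_set) (auto simp: lessThan_empty_iff)
  show "cross_cov (measure_pmf (pmf_of_set {..<k})) g g' m m $$ (i,j) = ?N $$ (i,j)"
    using assms ij by (simp add: cross_cov_def int unemb_def scalar_prod_def atLeast0LessThan)
qed (simp_all add: cross_cov_def unemb_def)

text \<open>Cyclic rotation gives the trace of L'^T P^T L, and a transposition brings it to the form
  in which the logit distance is expanded.\<close>

lemma mtrace_gram_pairing:
  assumes P: "P \<in> carrier_mat m m" and L: "L \<in> carrier_mat m k" and L': "L' \<in> carrier_mat m k"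
  shows "mtrace (transpose_mat P * (c \<cdot>\<^sub>m (L * transpose_mat L'))) = c * mtrace (transpose_mat L * P * L')"
proof -
  have LL: "L * transpose_mat L' \<in> carrier_mat m m" using L L' by simp
  have "transpose_mat P * (c \<cdot>\<^sub>m (L * transpose_mat L')) = c \<cdot>\<^sub>m (transpose_mat P * (L * transpose_mat L'))"
    using P LL by (intro mult_smult_distrib[of _ m m _ m]) auto
  also have "transpose_mat P * (L * transpose_mat L') = transpose_mat P * L * transpose_mat L'"
    using P L L' by (intro assoc_mult_mat[symmetric]) auto
  finally have "mtrace (transpose_mat P * (c \<cdot>\<^sub>m (L * transpose_mat L'))) = c * mtrace (transpose_mat P * L * transpose_mat L')"
    using P L L' by (simp add: mtrace_def sum_distrib_left)
  also have "mtrace (transpose_mat P * L * transpose_mat L') = mtrace (transpose_mat L' * (transpose_mat P * L))"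
    by (rule mtrace_comm[of _ m k]) (use P L L' in auto)
  also have "\<dots> = mtrace (transpose_mat (transpose_mat L' * (transpose_mat P * L)))"
    by (rule mtrace_transpose[symmetric, of _ k]) (use P L L' in \<open>auto intro: mult_carrier_mat\<close>)
  also have "transpose_mat (transpose_mat L' * (transpose_mat P * L)) = transpose_mat L * P * L'"
    using P L L' by (simp add: transpose_mult[of _ k m _ k] transpose_mult[of _ m m _ k])
  finally show ?thesis .
qed

theorem mainTheorem2:
  fixes M :: "'x measure" and f f' :: "'x \<Rightarrow> real vec" and g g' :: "nat \<Rightarrow> real vec"
    and m k :: nat
  assumes "prob_space M"
    and "0 < m"
    and "\<forall>x\<in>space M. dim_vec (f x) = m \<and> dim_vec (f' x) = m"
    and "\<forall>i<k. dim_vec (g i) = m \<and> dim_vec (g' i) = m"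
    and "\<forall>j<m. (\<lambda>x. vec_index (f x) j) \<in> borel_measurable M \<and> (\<lambda>x. vec_index (f' x) j) \<in> borel_measurable M"
    and "\<forall>j<m. integrable M (\<lambda>x. (vec_index (f x) j)\<^sup>2) \<and> integrable M (\<lambda>x. (vec_index (f' x) j)\<^sup>2)"
    and "\<forall>j<m. (\<Sum>i<k. vec_index (g i) j) = 0 \<and> (\<Sum>i<k. vec_index (g' i) j) = 0"
    and "invertible_mat (cov M f m)" and "invertible_mat (cov M f' m)"
    and "vec_space.rank m (unemb g m k) = m" and "vec_space.rank m (unemb g' m k) = m"
    and "eig_desc (cov M (logits f g k) k) m > 0"
  shows "m_CCA M f f' m \<ge> 1 - d_logit_sq M f g f' g' k / (real m * eig_desc (cov M (logits f g k) k) m)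
       \<and> m_CCA (measure_pmf (pmf_of_set {..<k})) g g' m
           \<ge> 1 - d_logit_sq M f g f' g' k / (real m * eig_desc (cov M (logits f g k) k) m)"
proof -
  define L L' where "L = unemb g m k" and "L' = unemb g' m k"
  define P where "P = measure_pmf (pmf_of_set {..<k})"
  define S S' C where "S = cov M f m" and "S' = cov M f' m" and "C = cross_cov M f f' m m"
  define T T' D where "T = cov P g m" and "T' = cov P g' m" and "D = cross_cov P g g' m m"
  define \<mu> d where "\<mu> = eig_desc (cov M (logits f g k) k) m" and "d = d_logit_sq M f g f' g' k"
  have L: "L \<in> carrier_mat m k" and L': "L' \<in> carrier_mat m k" by (simp_all add: L_def L'_def)
  have rank: "vec_space.rank m L = m" "vec_space.rank m L' = m" using assms(10,11) by (simp_all add: L_def L'_def)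
  \<comment> \<open>A matrix of rank \<open>m > 0\<close> has at least \<open>m\<close> columns, so
    the label set is nonempty and the uniform distribution is meaningful.\<close>
  have k: "0 < k" using vec_space.rank_le_nc[OF L] rank(1) assms(2) by simp
  have M: "prob_space M" and P: "prob_space P" by (simp_all add: assms P_def measure_pmf.prob_space_axioms)
  have f: "\<forall>j<m. sq_integrable M (\<lambda>x. f x $ j)" and f': "\<forall>j<m. sq_integrable M (\<lambda>x. f' x $ j)"
    using assms(5,6) by (auto simp: sq_integrable_def)
  have "finite (set_pmf (pmf_of_set {..<k}))" using k by (simp add: lessThan_empty_iff)
  then have sqP: "sq_integrable P h" for h :: "nat \<Rightarrow> real"
    unfolding sq_integrable_def P_def by (auto intro: integrable_measure_pmf_finite)
  have carr: "S \<in> carrier_mat m m" "S' \<in> carrier_mat m m" "C \<in> carrier_mat m m" 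
    "T \<in> carrier_mat m m" "T' \<in> carrier_mat m m" "D \<in> carrier_mat m m"
    by (simp_all add: S_def S'_def C_def T_def T'_def D_def cov_def)
  have sym: "transpose_mat S = S" "transpose_mat S' = S'" "transpose_mat T = T" "transpose_mat T' = T'"
    by (simp_all add: S_def S'_def T_def T'_def transpose_cov)
  have psd: "joint_psd m S C S'" "joint_psd m T D T'"
    unfolding S_def S'_def C_def T_def T'_def D_def using f f' sqP by (intro joint_psd_cross_cov M P; simp)+
  have pd: "pos_def m S" "pos_def m S'"
    unfolding S_def S'_def using assms(8,9) f f' by (intro invertible_cov_pos_def M; simp)+
  define c where "c = 1 / real k"
  have c: "0 < c" using k by (simp add: c_def)
  have T: "T = c \<cdot>\<^sub>m (L * transpose_mat L)" and T': "T' = c \<cdot>\<^sub>m (L' * transpose_mat L')" and D: "D = c \<cdot>\<^sub>m (L * transpose_mat L')"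
    unfolding T_def T'_def D_def cov_def P_def c_def L_def L'_def
    using assms(7) by (intro cross_cov_uniform_centered k; simp)+
  have pdT: "pos_def m T" and pdT': "pos_def m T'"
    unfolding T T' using c L L' rank by (auto intro: pos_def_smult full_row_rank_gram_pos_def)
  have \<mu>: "\<mu> = eig_desc (transpose_mat L * S * L) m" "0 < \<mu>"
    using assms(12) cov_logits[OF M f, of k g] assms(4) by (simp_all add: \<mu>_def L_def S_def)

  have tr: "mtrace (S * T) = c * mtrace (transpose_mat L * S * L)" 
    "mtrace (S' * T') = c * mtrace (transpose_mat L' * S' * L')" 
    "mtrace (transpose_mat C * D) = c * mtrace (transpose_mat L * C * L')"
    using mtrace_gram_pairing[OF carr(1) L L, of c] mtrace_gram_pairing[OF carr(2) L' L', of c] mtrace_gram_pairing[OF carr(3) L L', of c]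
    unfolding sym T[symmetric] T'[symmetric] D[symmetric] .
  have "mtrace (transpose_mat L * S * L) - 2 * mtrace (transpose_mat L * C * L') + mtrace (transpose_mat L' * S' * L') \<le> d"
    using d_logit_sq_ge_mtrace[OF M f f', of k g g'] assms(4) by (simp add: L_def L'_def S_def S'_def C_def d_def)
  then have "c * (mtrace (transpose_mat L * S * L) - 2 * mtrace (transpose_mat L * C * L') + mtrace (transpose_mat L' * S' * L')) \<le> c * d"
    using c by simp
  then have pairing: "mtrace (S * T) + mtrace (S' * T') - 2 * mtrace (transpose_mat C * D) \<le> c * d"
    unfolding tr by (simp add: algebra_simps)

  \<comment> \<open>Both applications of the trace inequality carry the label weight
    \<open>c\<close> on both sides; here it cancels.\<close>
  have bound: "1 - d / (real m * \<mu>) \<le> s / real m" if "\<mu> * c * (real m - s) \<le> c * d" for s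
  proof -
    have "\<mu> * (real m - s) \<le> d" using that c by (simp add: mult.assoc mult.left_commute[of \<mu>])
    then have "real m - s \<le> d / \<mu>" using \<mu>(2) by (simp add: field_simps)
    then have "(real m - s) / real m \<le> d / \<mu> / real m" by (rule divide_right_mono) simp
    then show ?thesis using assms(2) by (simp add: diff_divide_distrib mult.commute)
  qed
  have \<mu>c: "0 < \<mu> * c" using \<mu> c by simp
  \<comment> \<open>For the embeddings the needed domination is T >= mu c S^(-1), the bound on L L^T
    scaled by \<open>c\<close>.\<close>
  have "\<mu> * c * ((inv_sqrt_mat m S *\<^sub>v v) \<bullet> (inv_sqrt_mat m S *\<^sub>v v)) \<le> v \<bullet> (T *\<^sub>v v)" if v: "v \<in> carrier_vec m" for v
  proof -
    have LLv: "(L * transpose_mat L) *\<^sub>v v \<in> carrier_vec m" using L v by (auto intro: mult_mat_vec_carrier[of _ m m])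
    show ?thesis
      using mult_left_mono[OF gram_ge_inverse[OF carr(1) sym(1) pd(1) L rank(1) assms(2) \<mu> v], of c] c LLv v L
      unfolding T by (simp add: smult_mat_mult_vec mult_ac)
  qed
  from cross_trace_lower_bound[OF carr(1) sym(1) pd(1) carr(2) sym(2) pd(2) carr(3) psd(1) carr(4) sym(3) carr(5,6) psd(2) this \<mu>c]
  have 1: "1 - d / (real m * \<mu>) \<le> m_CCA M f f' m"
    unfolding m_CCA_def Let_def S_def[symmetric] S'_def[symmetric] C_def[symmetric]
    by (intro bound order_trans[OF _ pairing])
  \<comment> \<open>For the unembeddings \<open>S\<close> and \<open>T\<close> exchange roles, and S
    >= mu c T^(-1) holds with the same constant.\<close>
  have "\<mu> * c * ((inv_sqrt_mat m T *\<^sub>v v) \<bullet> (inv_sqrt_mat m T *\<^sub>v v)) \<le> v \<bullet> (S *\<^sub>v v)" if v: "v \<in> carrier_vec m" for v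
    unfolding T by (rule ge_gram_inverse[OF carr(1) sym(1) pd(1) L rank(1) assms(2) \<mu> c v])
  note 2 = cross_trace_lower_bound[OF carr(4) sym(3) pdT carr(5) sym(4) pdT' carr(6) psd(2) carr(1) sym(1) carr(2,3) psd(1) this \<mu>c]
  \<comment> \<open>The exchange transposes the cross term, which leaves its trace unchanged, so
    \<open>pairing\<close> serves both bounds.\<close>
  have "mtrace (transpose_mat D * C) = mtrace (transpose_mat C * D)"
    using mtrace_transpose[of "transpose_mat C * D" m] carr by (simp add: transpose_mult[of _ m m _ m])
  then have "mtrace (T * S) + mtrace (T' * S') - 2 * mtrace (transpose_mat D * C) \<le> c * d"
    using pairing mtrace_comm[OF carr(1,4)] mtrace_comm[OF carr(2,5)] by simp
  then have 3: "1 - d / (real m * \<mu>) \<le> m_CCA P g g' m"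
    unfolding m_CCA_def Let_def T_def[symmetric] T'_def[symmetric] D_def[symmetric]
    by (intro bound order_trans[OF 2])
  show ?thesis using 1 3 unfolding P_def \<mu>_def d_def by blast
qed

end
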